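(* Let $\mathbb K$ be $\mathbb R$, $\mathbb C$, or a field of characteristic $p>0$, and let $\mathfrak n=\bigoplus_{k=-d}^{-1}\mathfrak n_k$ be an $n$-dimensional $\mathbb Z$-graded Lie algebra (or Lie superalgebra) over $\mathbb K$ of depth $d>1$ which is generated by $\mathfrak n_{-1}$. Let $e_1,\dots,e_n$ be a basis of $\mathfrak n$ compatible with the grading, let $I_s$ be the set of indices $i$ with $e_i\in\mathfrak n_{-s}$, and let $\mathfrak v=\bigoplus_{k\ge -d}\mathfrak v_k$ denote $\mathfrak{vect}(n)$ with the $\mathbb Z$-grading determined by $\deg x_i=s$ for $i\in I_s$. Then there exists an embedding of Lie algebras (resp. Lie superalgebras) $f:\mathfrak n\to\mathfrak{vect}(n)$ such that, writing $X_i=f(e_i)$, one has $X_i\in\mathfrak v_{-s}$ for every $i\in I_s$ and the value of $X_i$ at $0$ is $\partial_i$ for all $i=1,\dots,n$. In particular, $\dim f(\mathfrak n)(0)=n$, where $f(\mathfrak n)(0)$ is the span of the values at $0$ of the vector fields in $f(\mathfrak n)$.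
   Context: Functions and vector fields: let $x_1,\dots,x_n$ be coordinates determined by the basis $e_1,\dots,e_n$ (in the super case $x_i$ has the parity of $e_i$). If $\mathbb K=\mathbb R$ or $\mathbb C$, let $\mathcal O$ be the algebra of polynomials in the $x_i$ (in the super case, the free supercommutative algebra on the $x_i$). If $\operatorname{char}\mathbb K=p>0$, $\mathcal O$ is the algebra of divided powers in the even $x_i$ (spanned by products of $x_i^{(k)}$, $k\ge 0$, with $x_i^{(k)}x_i^{(l)}=\binom{k+l}{k}x_i^{(k+l)}$ and $\partial_i x_i^{(k)}=x_i^{(k-1)}$), tensored in the super case with the Grassmann algebra of the odd $x_i$. $\mathfrak{vect}(n)$ is the Lie (super)algebra of vector fields $\sum_i f_i\partial_i$ with $f_i\in\mathcal O$, where $\partial_i=\partial/\partial x_i$; $\partial_i$ has degree $-\deg x_i$, and $x_i^{(k)}$ has degree $k\deg x_i$. A basis is compatible with the grading if it is a union of bases of the $\mathfrak n_{-s}$, listed in order $s=1,2,\dots,d$. Depth $d$ means $\mathfrak n_{-d}\neq 0$ and $\mathfrak n_k=0$ for $k<-d$. For Lie superalgebras the usual definitions are used; in characteristic $3$ this includes $[x,[x,x]]=0$ for odd $x$, and in characteristic $2$ it includes the squaring $x\mapsto x^2$ on odd elements (homomorphisms, subalgebras and generation respect squaring). *)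

theory Defs
  imports Complex_Main "HOL-Library.Poly_Mapping"
begin

section \<open>Ground fields\<close>

definition field_iso :: "('a::field \<Rightarrow> 'b::field) \<Rightarrow> bool" where
  "field_iso \<phi> \<longleftrightarrow> bij \<phi> \<and> (\<forall>x y. \<phi> (x + y) = \<phi> x + \<phi> y) \<and> (\<forall>x y. \<phi> (x * y) = \<phi> x * \<phi> y)"

definition real_complex_or_pos_char :: "'k::field itself \<Rightarrow> bool" where
  "real_complex_or_pos_char _ \<longleftrightarrow>
     (\<exists>\<phi> :: 'k \<Rightarrow> real. field_iso \<phi>) \<or> (\<exists>\<phi> :: 'k \<Rightarrow> complex. field_iso \<phi>) \<or> CHAR('k) > 0"

section \<open>Lie algebras and Lie superalgebras\<close>

definition signed :: "bool \<Rightarrow> 'a::group_add \<Rightarrow> 'a" where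
  "signed b x = (if b then - x else x)"

locale lie_algebra = vector_space scale
  for scale :: "'k::field \<Rightarrow> 'a::ab_group_add \<Rightarrow> 'a" +
  fixes br :: "'a \<Rightarrow> 'a \<Rightarrow> 'a"
  assumes br_linear_left: "Vector_Spaces.linear scale scale (\<lambda>x. br x y)"
    and br_linear_right: "Vector_Spaces.linear scale scale (br x)"
    and br_self: "br x x = 0"
    and jacobi: "br x (br y z) + br y (br z x) + br z (br x y) = 0"

text \<open>
  Parities are Booleans: \<open>par False\<close> is the even and \<open>par True\<close> the odd part, and addition of
  parities is \<open>\<noteq>\<close>. The squaring \<open>sq\<close> is part of the structure in characteristic 2 only; in
  other characteristics it is an unconstrained dummy that nothing below depends on. In
  characteristic 2 the identity \<open>[x\<^sup>2, y] = [x, [x, y]]\<close> is required for all \<open>y\<close>, odd ones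
  included. Over fields with more than 2 elements, for odd \<open>y\<close> it follows from
  \<open>[x\<^sup>2, x] = 0\<close> by polarization, but over the field with 2 elements it does not, and there
  vector fields satisfy the stronger identity.
\<close>
locale lie_superalgebra = vector_space scale
  for scale :: "'k::field \<Rightarrow> 'a::ab_group_add \<Rightarrow> 'a" +
  fixes br :: "'a \<Rightarrow> 'a \<Rightarrow> 'a"
    and sq :: "'a \<Rightarrow> 'a"
    and par :: "bool \<Rightarrow> 'a set"
  assumes par_subspace: "subspace (par p)"
    and par_disjoint: "par False \<inter> par True = {0}"
    and par_sum: "\<exists>x0\<in>par False. \<exists>x1\<in>par True. x = x0 + x1"
    and br_linear_left: "Vector_Spaces.linear scale scale (\<lambda>x. br x y)"
    and br_linear_right: "Vector_Spaces.linear scale scale (br x)"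
    and br_par: "\<lbrakk>x \<in> par p; y \<in> par q\<rbrakk> \<Longrightarrow> br x y \<in> par (p \<noteq> q)"
    and br_antisym: "\<lbrakk>x \<in> par p; y \<in> par q\<rbrakk> \<Longrightarrow> br x y = - signed (p \<and> q) (br y x)"
    and br_even_self: "x \<in> par False \<Longrightarrow> br x x = 0"
    and super_jacobi: "\<lbrakk>x \<in> par p; y \<in> par q; z \<in> par r\<rbrakk> \<Longrightarrow>
          br x (br y z) = br (br x y) z + signed (p \<and> q) (br y (br x z))"
    and char3_odd: "\<lbrakk>CHAR('k) = 3; x \<in> par True\<rbrakk> \<Longrightarrow> br x (br x x) = 0"
    and sq_even: "\<lbrakk>CHAR('k) = 2; x \<in> par True\<rbrakk> \<Longrightarrow> sq x \<in> par False"
    and sq_scale: "\<lbrakk>CHAR('k) = 2; x \<in> par True\<rbrakk> \<Longrightarrow> sq (scale c x) = scale (c\<^sup>2) (sq x)"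
    and sq_add: "\<lbrakk>CHAR('k) = 2; x \<in> par True; y \<in> par True\<rbrakk> \<Longrightarrow>
          sq (x + y) = sq x + sq y + br x y"
    and sq_br: "\<lbrakk>CHAR('k) = 2; x \<in> par True\<rbrakk> \<Longrightarrow> br (sq x) y = br x (br x y)"

definition purely_even :: "bool \<Rightarrow> 'a::zero set" where
  "purely_even p = (if p then {0} else UNIV)"

text \<open>Lie algebras are the Lie superalgebras with zero odd part.\<close>
lemma lie_superalgebra_purely_even_iff:
  fixes scale :: "'k::field \<Rightarrow> 'a::ab_group_add \<Rightarrow> 'a"
  shows "lie_superalgebra scale br (\<lambda>_. 0) purely_even \<longleftrightarrow> lie_algebra scale br"
proof
  assume "lie_superalgebra scale br (\<lambda>_. 0) purely_even"
  then interpret S: lie_superalgebra scale br "\<lambda>_. 0" purely_even .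
  have anti: "br x y = - br y x" for x y
    using S.br_antisym[of x False y False] by (simp add: purely_even_def signed_def)
  have neg: "br x (- y) = - br x y" for x y
    using S.br_linear_right[of x] module_hom.neg[of scale scale "br x" y]
    by (simp add: Vector_Spaces.linear_def)
  show "lie_algebra scale br"
  proof (intro lie_algebra.intro lie_algebra_axioms.intro)
    show "vector_space scale" ..
    show "Vector_Spaces.linear scale scale (\<lambda>x. br x y)" for y by (rule S.br_linear_left)
    show "Vector_Spaces.linear scale scale (br x)" for x by (rule S.br_linear_right)
    show "br x x = 0" for x using S.br_even_self[of x] by (simp add: purely_even_def)
    show "br x (br y z) + br y (br z x) + br z (br x y) = 0" for x y z
    proof -
      have "br x (br y z) = br (br x y) z + br y (br x z)"
        using S.super_jacobi[of x False y False z False]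
        by (simp add: purely_even_def signed_def)
      moreover have "br (br x y) z = - br z (br x y)" by (rule anti)
      moreover have "br y (br x z) = - br y (br z x)" by (subst anti[of x z]) (rule neg)
      ultimately show ?thesis by simp
    qed
  qed
next
  assume "lie_algebra scale br"
  then interpret L: lie_algebra scale br .
  have lin: "module_hom scale scale (\<lambda>x. br x y)" "module_hom scale scale (br x)" for x y
    using L.br_linear_left[of y] L.br_linear_right[of x]
    by (simp_all add: Vector_Spaces.linear_def)
  have zero: "br 0 x = 0" "br x 0 = 0" for x
    using module_hom.zero[OF lin(1)] module_hom.zero[OF lin(2)] by auto
  have anti: "br x y = - br y x" for x y
  proof -
    have "br (x + y) (x + y) = br x x + br y y + (br x y + br y x)"
      by (simp add: module_hom.add[OF lin(1)] module_hom.add[OF lin(2)])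
    then show ?thesis by (simp add: L.br_self eq_neg_iff_add_eq_0)
  qed
  have jac: "br x (br y z) = br (br x y) z + br y (br x z)" for x y z
  proof -
    have "br x (br y z) = - br y (br z x) - br z (br x y)"
      using L.jacobi[of x y z] by (simp add: eq_neg_iff_add_eq_0 algebra_simps)
    moreover have "br (br x y) z = - br z (br x y)" by (rule anti)
    moreover have "br y (br x z) = - br y (br z x)"
      by (subst anti[of x z]) (rule module_hom.neg[OF lin(2)])
    ultimately show ?thesis by simp
  qed
  show "lie_superalgebra scale br (\<lambda>_. 0) purely_even"
  proof (intro lie_superalgebra.intro lie_superalgebra_axioms.intro)
    show "vector_space scale" ..
    show "L.subspace (purely_even p)" for p
      by (auto simp: purely_even_def L.subspace_def)
    show "br x y \<in> purely_even (p \<noteq> q)"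
      if "x \<in> purely_even p" "y \<in> purely_even q" for x y p q
      using that by (auto simp: purely_even_def zero split: if_splits)
    show "br x y = - signed (p \<and> q) (br y x)"
      if "x \<in> purely_even p" "y \<in> purely_even q" for x y p q
      using that anti[of x y] by (auto simp: purely_even_def signed_def zero split: if_splits)
    show "br x (br y z) = br (br x y) z + signed (p \<and> q) (br y (br x z))"
      if "x \<in> purely_even p" "y \<in> purely_even q" "z \<in> purely_even r" for x y z p q r
      using that jac[of x y z] by (auto simp: purely_even_def signed_def zero split: if_splits)
    show "Vector_Spaces.linear scale scale (\<lambda>x. br x y)" for y by (rule L.br_linear_left)
    show "Vector_Spaces.linear scale scale (br x)" for x by (rule L.br_linear_right)
  qed (auto simp: purely_even_def zero L.br_self)
qed

definition index_set :: "nat \<Rightarrow> (int \<Rightarrow> 'a set) \<Rightarrow> (nat \<Rightarrow> 'a) \<Rightarrow> nat \<Rightarrow> nat set" where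
  "index_set n N e s = {i \<in> {1..n}. e i \<in> N (- int s)}"

definition odd_indices :: "nat \<Rightarrow> (bool \<Rightarrow> 'a set) \<Rightarrow> (nat \<Rightarrow> 'a) \<Rightarrow> nat set" where
  "odd_indices n par e = {i \<in> {1..n}. e i \<in> par True}"

context lie_superalgebra
begin

definition subsuperspace :: "'a set \<Rightarrow> bool" where
  "subsuperspace S \<longleftrightarrow> subspace S \<and>
     (\<forall>x\<in>S. \<exists>x0\<in>S \<inter> par False. \<exists>x1\<in>S \<inter> par True. x = x0 + x1)"

definition subsuperalgebra :: "'a set \<Rightarrow> bool" where
  "subsuperalgebra S \<longleftrightarrow> subsuperspace S \<and> (\<forall>x\<in>S. \<forall>y\<in>S. br x y \<in> S) \<and>
     (CHAR('k) = 2 \<longrightarrow> (\<forall>x\<in>S \<inter> par True. sq x \<in> S))"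

definition generated_by :: "'a set \<Rightarrow> bool" where
  "generated_by G \<longleftrightarrow> (\<forall>S. subsuperalgebra S \<and> G \<subseteq> S \<longrightarrow> S = UNIV)"

definition graded :: "(int \<Rightarrow> 'a set) \<Rightarrow> bool" where
  "graded N \<longleftrightarrow>
     (\<forall>k. subsuperspace (N k)) \<and>
     (\<forall>x. \<exists>!c. (\<forall>k. c k \<in> N k) \<and> finite {k. c k \<noteq> 0} \<and> x = (\<Sum>k | c k \<noteq> 0. c k)) \<and>
     (\<forall>k l. \<forall>x\<in>N k. \<forall>y\<in>N l. br x y \<in> N (k + l)) \<and>
     (CHAR('k) = 2 \<longrightarrow> (\<forall>k. \<forall>x\<in>N k \<inter> par True. sq x \<in> N (2 * k)))"

definition negatively_graded_of_depth :: "nat \<Rightarrow> (int \<Rightarrow> 'a set) \<Rightarrow> bool" where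
  "negatively_graded_of_depth d N \<longleftrightarrow> graded N \<and>
     N (- int d) \<noteq> {0} \<and> (\<forall>k < - int d. N k = {0}) \<and> (\<forall>k\<ge>0. N k = {0})"

text \<open>
  A basis of the superspace is understood to consist of homogeneous (even or odd) vectors. The
  last condition says that the basis is listed in order of increasing \<open>s\<close>.
\<close>
definition compatible_basis :: "nat \<Rightarrow> nat \<Rightarrow> (int \<Rightarrow> 'a set) \<Rightarrow> (nat \<Rightarrow> 'a) \<Rightarrow> bool" where
  "compatible_basis d n N e \<longleftrightarrow>
     inj_on e {1..n} \<and> independent (e ` {1..n}) \<and> span (e ` {1..n}) = UNIV \<and>
     (\<forall>i\<in>{1..n}. e i \<in> par False \<union> par True) \<and>
     {1..n} = (\<Union>s\<in>{1..d}. index_set n N e s) \<and>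
     (\<forall>s\<in>{1..d}. span (e ` index_set n N e s) = N (- int s)) \<and>
     (\<forall>s\<in>{1..d}. \<forall>t\<in>{1..d}. s < t \<longrightarrow>
        (\<forall>i\<in>index_set n N e s. \<forall>j\<in>index_set n N e t. i < j))"

end

section \<open>The algebra of functions\<close>

abbreviation "lookup \<equiv> Poly_Mapping.lookup"
abbreviation "keys \<equiv> Poly_Mapping.keys"

text \<open>
  A monomial is an exponent vector \<open>a\<close>. With \<open>J\<close> the set of indices of the odd variables, \<open>a\<close>
  stands for the product of the factors \<open>x\<^sub>i^(a i)\<close> (characteristic 0) or of the divided
  powers \<open>x\<^sub>i^((a i))\<close> (positive characteristic) over the even \<open>x\<^sub>i\<close>, followed by the product of
  the odd \<open>x\<^sub>i\<close> with \<open>a i = 1\<close> in increasing order of \<open>i\<close>.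
\<close>
type_synonym monom = "nat \<Rightarrow>\<^sub>0 nat"
type_synonym 'k func = "monom \<Rightarrow>\<^sub>0 'k"

definition func_space :: "nat \<Rightarrow> nat set \<Rightarrow> 'k::field func set" where
  "func_space n J = {f. \<forall>a\<in>keys f. keys a \<subseteq> {1..n} \<and> (\<forall>i\<in>J. lookup a i \<le> 1)}"

definition even_coeff :: "nat \<Rightarrow> nat \<Rightarrow> 'k::field" where
  "even_coeff k l = (if CHAR('k) = 0 then 1 else of_nat ((k + l) choose k))"

text \<open>
  The product of the monomials \<open>a\<close> and \<open>b\<close> is \<open>monom_coeff J a b\<close> times the monomial \<open>a + b\<close>.
  The sign counts the transpositions of odd variables needed to sort the product.
\<close>
definition monom_coeff :: "nat set \<Rightarrow> monom \<Rightarrow> monom \<Rightarrow> 'k::field" where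
  "monom_coeff J a b =
     (if \<exists>i\<in>J. lookup a i + lookup b i > 1 then 0
      else (- 1) ^ card {(i, j). i \<in> J \<inter> keys a \<and> j \<in> J \<inter> keys b \<and> j < i} *
        (\<Prod>i\<in>keys a - J. even_coeff (lookup a i) (lookup b i)))"

definition func_mult :: "nat set \<Rightarrow> 'k::field func \<Rightarrow> 'k func \<Rightarrow> 'k func" where
  "func_mult J f g = (\<Sum>a\<in>keys f. \<Sum>b\<in>keys g.
     Poly_Mapping.single (a + b) (monom_coeff J a b * lookup f a * lookup g b))"

text \<open>
  The partial derivatives are left superderivations, so for odd \<open>x\<^sub>i\<close> a sign arises from moving
  \<open>\<partial>\<^sub>i\<close> past the odd variables that precede \<open>x\<^sub>i\<close>.
\<close>
definition deriv_coeff :: "nat set \<Rightarrow> nat \<Rightarrow> monom \<Rightarrow> 'k::field" where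
  "deriv_coeff J i a =
     (if i \<in> J then (- 1) ^ card {j \<in> J \<inter> keys a. j < i}
      else if CHAR('k) = 0 then of_nat (lookup a i) else 1)"

definition partial_deriv :: "nat set \<Rightarrow> nat \<Rightarrow> 'k::field func \<Rightarrow> 'k func" where
  "partial_deriv J i f = (\<Sum>a | a \<in> keys f \<and> lookup a i \<noteq> 0.
     Poly_Mapping.single (a - Poly_Mapping.single i 1) (deriv_coeff J i a * lookup f a))"

section \<open>Vector fields\<close>

text \<open>\<open>X\<close> stands for the vector field \<open>\<Sum>\<^sub>i (lookup X i) \<partial>\<^sub>i\<close>.\<close>
type_synonym 'k vfield = "nat \<Rightarrow>\<^sub>0 'k func"

definition vf_scale :: "'k::field \<Rightarrow> 'k vfield \<Rightarrow> 'k vfield" where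
  "vf_scale c X = Poly_Mapping.map (Poly_Mapping.map ((*) c)) X"

lemma lookup_vf_scale: "lookup (lookup (vf_scale c X) i) a = c * lookup (lookup X i) a"
  by (simp add: vf_scale_def Poly_Mapping.map.rep_eq when_def)

lemma vfield_eqI:
  assumes "\<And>i a. lookup (lookup X i) a = lookup (lookup Y i) a"
  shows "X = (Y :: 'k::field vfield)"
  using assms by (intro poly_mapping_eqI) auto

interpretation vf: vector_space vf_scale
  by unfold_locales
    (auto intro!: vfield_eqI simp: lookup_vf_scale lookup_add algebra_simps)

definition vect :: "nat \<Rightarrow> nat set \<Rightarrow> 'k::field vfield set" where
  "vect n J = {X. keys X \<subseteq> {1..n} \<and> (\<forall>i. lookup X i \<in> func_space n J)}"

definition vf_apply :: "nat set \<Rightarrow> 'k::field vfield \<Rightarrow> 'k func \<Rightarrow> 'k func" where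
  "vf_apply J X g = (\<Sum>i\<in>keys X. func_mult J (lookup X i) (partial_deriv J i g))"

text \<open>The vector field with components \<open>X(Y\<^sub>j)\<close>.\<close>
definition vf_comp :: "nat set \<Rightarrow> 'k::field vfield \<Rightarrow> 'k vfield \<Rightarrow> 'k vfield" where
  "vf_comp J X Y = (\<Sum>j\<in>keys Y. Poly_Mapping.single j (vf_apply J X (lookup Y j)))"

text \<open>The parity of the vector field \<open>x^a \<partial>\<^sub>j\<close>.\<close>
definition term_odd :: "nat set \<Rightarrow> monom \<Rightarrow> nat \<Rightarrow> bool" where
  "term_odd J a j \<longleftrightarrow> (odd (\<Sum>i\<in>J \<inter> keys a. lookup a i) \<noteq> (j \<in> J))"

definition vect_par :: "nat \<Rightarrow> nat set \<Rightarrow> bool \<Rightarrow> 'k::field vfield set" where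
  "vect_par n J p =
     {X \<in> vect n J. \<forall>j. \<forall>a\<in>keys (lookup X j). term_odd J a j = p}"

definition vf_part :: "nat set \<Rightarrow> bool \<Rightarrow> 'k::field vfield \<Rightarrow> 'k vfield" where
  "vf_part J p X = (\<Sum>j\<in>keys X. \<Sum>a | a \<in> keys (lookup X j) \<and> term_odd J a j = p.
     Poly_Mapping.single j (Poly_Mapping.single a (lookup (lookup X j) a)))"

text \<open>
  For homogeneous \<open>X\<close> and \<open>Y\<close> of parities \<open>p\<close> and \<open>q\<close> the bracket has the components
  \<open>X(Y\<^sub>j) - (-1)^(p q) Y(X\<^sub>j)\<close>; it is extended biadditively.
\<close>
definition vf_bracket :: "nat set \<Rightarrow> 'k::field vfield \<Rightarrow> 'k vfield \<Rightarrow> 'k vfield" where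
  "vf_bracket J X Y = (\<Sum>p\<in>UNIV. \<Sum>q\<in>UNIV.
     vf_comp J (vf_part J p X) (vf_part J q Y) -
     signed (p \<and> q) (vf_comp J (vf_part J q Y) (vf_part J p X)))"

text \<open>In characteristic 2, the square of an odd vector field as an operator on functions.\<close>
definition vf_square :: "nat set \<Rightarrow> 'k::field vfield \<Rightarrow> 'k vfield" where
  "vf_square J X = vf_comp J X X"

definition vect_deg :: "nat \<Rightarrow> nat set \<Rightarrow> (nat \<Rightarrow> nat) \<Rightarrow> int \<Rightarrow> 'k::field vfield set" where
  "vect_deg n J wt k = {X \<in> vect n J. \<forall>j. \<forall>a\<in>keys (lookup X j).
     (\<Sum>i\<in>keys a. int (lookup a i * wt i)) - int (wt j) = k}"

definition vf_partial :: "nat \<Rightarrow> 'k::field vfield" where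
  "vf_partial i = Poly_Mapping.single i (Poly_Mapping.single 0 1)"

text \<open>The tangent vector at \<open>0\<close> is identified with the vector field with constant coefficients.\<close>
definition value_at_0 :: "'k::field vfield \<Rightarrow> 'k vfield" where
  "value_at_0 X = Poly_Mapping.map (\<lambda>f. Poly_Mapping.single 0 (lookup f 0)) X"

definition (in lie_superalgebra) embedding_into_vect ::
    "nat \<Rightarrow> nat set \<Rightarrow> ('a \<Rightarrow> 'k vfield) \<Rightarrow> bool" where
  "embedding_into_vect n J f \<longleftrightarrow>
     Vector_Spaces.linear scale vf_scale f \<and> inj f \<and> range f \<subseteq> vect n J \<and>
     (\<forall>p. \<forall>x\<in>par p. f x \<in> vect_par n J p) \<and>
     (\<forall>x y. f (br x y) = vf_bracket J (f x) (f y)) \<and>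
     (CHAR('k) = 2 \<longrightarrow> (\<forall>x\<in>par True. f (sq x) = vf_square J (f x)))"

end

theory Submission
  imports Defs
begin

text \<open>
  Since the basis is listed by increasing depth, the span of \<open>e\<^sub>i, \<dots>, e\<^sub>n\<close> is an ideal for every
  \<open>i\<close>, and \<open>D = [e\<^sub>i, -]\<close> is nilpotent on it. By descending induction on \<open>i\<close>, each of these ideals
  is realized by vector fields in \<open>x\<^sub>i, \<dots>, x\<^sub>n\<close>. Let \<open>F\<close> realize the span of
  \<open>e\<^sub>i\<^sub>+\<^sub>1, \<dots>, e\<^sub>n\<close>.

  If \<open>e\<^sub>i\<close> is even, send \<open>e\<^sub>i\<close> to \<open>\<partial>\<^sub>i\<close> and \<open>y\<close> to \<open>\<Sum>\<^sub>k x\<^sub>i^(k) F(D^k y)\<close>, that is, to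
  \<open>F(exp(x\<^sub>i D) y)\<close>. This respects brackets because \<open>exp(x\<^sub>i D)\<close> is an automorphism, and the
  divided powers make the series meaningful in every characteristic.

  If \<open>e\<^sub>i\<close> is odd, let \<open>q\<close> be its square, that is \<open>[e\<^sub>i, e\<^sub>i] / 2\<close> outside characteristic 2, so that
  \<open>D\<^sup>2 = [q, -]\<close> and \<open>D q = 0\<close>. Send \<open>e\<^sub>i\<close> to \<open>\<partial>\<^sub>i + x\<^sub>i F(q)\<close>, whose square is \<open>F(q)\<close>, and \<open>y\<close> to
  \<open>F(y) + x\<^sub>i F(D y)\<close>.
\<close>

section \<open>Bilinearity of the operations on vector fields\<close>

lemma func_mult_add_left: "func_mult J (f + f') g = func_mult J f g + func_mult J f' g"
  unfolding func_mult_def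
  by (rule setsum_keys_plus_distrib)
     (simp_all add: sum.distrib[symmetric] single_add[symmetric] algebra_simps)

lemma func_mult_add_right: "func_mult J f (g + g') = func_mult J f g + func_mult J f g'"
  unfolding func_mult_def sum.distrib[symmetric]
  by (intro sum.cong refl setsum_keys_plus_distrib)
     (simp_all add: single_add[symmetric] algebra_simps)

text \<open>The condition is moved from the index set into the summand, so that the additivity of
  sums over \<open>keys\<close> applies to \<open>partial_deriv\<close>.\<close>

lemma partial_deriv_alt: "partial_deriv J i f =
  (\<Sum>a\<in>keys f. if lookup a i \<noteq> 0
     then Poly_Mapping.single (a - Poly_Mapping.single i 1) (deriv_coeff J i a * lookup f a) else 0)"
  unfolding partial_deriv_def by (rule sum.inter_filter) simp

lemma partial_deriv_add: "partial_deriv J i (f + g) = partial_deriv J i f + partial_deriv J i g"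
  unfolding partial_deriv_alt
  by (rule setsum_keys_plus_distrib) (simp_all add: single_add[symmetric] algebra_simps)

lemma func_mult_zero [simp]: "func_mult J 0 g = 0" "func_mult J f 0 = 0"
  by (simp_all add: func_mult_def)

lemma partial_deriv_zero [simp]: "partial_deriv J i 0 = 0"
  by (simp add: partial_deriv_def)

lemma vf_apply_add_left: "vf_apply J (X + X') g = vf_apply J X g + vf_apply J X' g"
  unfolding vf_apply_def by (rule setsum_keys_plus_distrib) (simp_all add: func_mult_add_left)

lemma vf_apply_add_right: "vf_apply J X (g + g') = vf_apply J X g + vf_apply J X g'"
  by (simp add: vf_apply_def partial_deriv_add func_mult_add_right sum.distrib)

lemma vf_apply_zero [simp]: "vf_apply J 0 g = 0" "vf_apply J X 0 = 0"
  by (simp_all add: vf_apply_def)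

lemma vf_comp_add_left: "vf_comp J (X + X') Y = vf_comp J X Y + vf_comp J X' Y"
  by (simp add: vf_comp_def vf_apply_add_left single_add sum.distrib)

lemma vf_comp_add_right: "vf_comp J X (Y + Y') = vf_comp J X Y + vf_comp J X Y'"
  unfolding vf_comp_def
  by (rule setsum_keys_plus_distrib) (simp_all add: vf_apply_add_right single_add)

lemma vf_comp_zero [simp]: "vf_comp J 0 Y = 0" "vf_comp J X 0 = 0"
  by (simp_all add: vf_comp_def)

lemma single_eq_zero_iff [simp]: "Poly_Mapping.single a c = 0 \<longleftrightarrow> c = 0"
  by (metis lookup_single_eq lookup_zero single_zero)

abbreviation vmon :: "nat \<Rightarrow> monom \<Rightarrow> 'k::field \<Rightarrow> 'k vfield" where
  "vmon j a c \<equiv> Poly_Mapping.single j (Poly_Mapping.single a c)"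

text \<open>Together with biadditivity this formula determines \<open>vf_comp\<close>. The case
  \<open>lookup b i = 0\<close> is split off because the subtraction of exponents is
  truncated.\<close>

lemma vf_comp_vmon:
  "vf_comp J (vmon i a c) (vmon j b c') =
     (if lookup b i = 0 then 0 else
      vmon j (a + (b - Poly_Mapping.single i 1))
        (monom_coeff J a (b - Poly_Mapping.single i 1) * deriv_coeff J i b * (c * c')))"
proof -
  have "partial_deriv J i (Poly_Mapping.single b c') =
    (if lookup b i = 0 then 0
     else Poly_Mapping.single (b - Poly_Mapping.single i 1) (deriv_coeff J i b * c'))" for c' :: 'a
    by (auto simp: partial_deriv_alt)
  moreover have "func_mult J (Poly_Mapping.single a c) (Poly_Mapping.single b c') =
    Poly_Mapping.single (a + b) (monom_coeff J a b * (c * c'))" for b and c' :: 'a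
    by (auto simp: func_mult_def mult.assoc)
  ultimately show ?thesis
    by (auto simp: vf_comp_def vf_apply_def mult_ac)
qed

section \<open>Supports of vector fields and induction on terms\<close>

lemma sum_single_lookup: "(\<Sum>a\<in>keys f. Poly_Mapping.single a (lookup f a)) = f"
  by (rule poly_mapping_eqI) (auto simp: lookup_sum lookup_single when_def in_keys_iff)

lemma single_sum: "Poly_Mapping.single j (sum f A) = (\<Sum>x\<in>A. Poly_Mapping.single j (f x))"
  by (induction A rule: infinite_finite_induct) (auto simp: single_add)

text \<open>One notion covers parity, degree and the variables involved: each is a condition on the
  terms \<open>x^a \<partial>\<^sub>j\<close>, and the fields all of whose terms satisfy it form a
  subspace.\<close>

definition vf_supp :: "(nat \<Rightarrow> monom \<Rightarrow> bool) \<Rightarrow> 'k::field vfield set" where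
  "vf_supp P = {X. \<forall>j. \<forall>a\<in>keys (lookup X j). P j a}"

text \<open>A field is the sum of its terms, so an additive property need only be checked on the
  terms that satisfy \<open>P\<close>.\<close>

lemma vf_supp_induct [consumes 1, case_names zero add vmon]:
  assumes "X \<in> vf_supp P" "Q 0"
    and add: "\<And>X Y. Q X \<Longrightarrow> Q Y \<Longrightarrow> Q (X + Y)"
    and vmon: "\<And>j a c. P j a \<Longrightarrow> Q (vmon j a c)"
  shows "Q X"
proof -
  have sumI: "Q (sum f A)" if "finite A" "\<And>x. x \<in> A \<Longrightarrow> Q (f x)" for f and A :: "'x set"
    using that by (induction A rule: finite_induct) (auto intro: add assms(2))
  have "X = (\<Sum>j\<in>keys X. \<Sum>a\<in>keys (lookup X j). vmon j a (lookup (lookup X j) a))"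
    by (simp add: sum_single_lookup flip: single_sum)
  also have "Q \<dots>"
    using assms(1) by (intro sumI vmon) (auto simp: vf_supp_def)
  finally show ?thesis .
qed

lemma vf_supp_zero [simp]: "0 \<in> vf_supp P"
  by (simp add: vf_supp_def)

lemma vf_supp_vmon: "vmon j a c \<in> vf_supp P \<longleftrightarrow> c = 0 \<or> P j a"
  by (auto simp: vf_supp_def lookup_single when_def)

lemma vf_supp_add: "X \<in> vf_supp P \<Longrightarrow> Y \<in> vf_supp P \<Longrightarrow> X + Y \<in> vf_supp P"
  using keys_add by (fastforce simp: vf_supp_def lookup_add)

lemma vf_supp_scale: "X \<in> vf_supp P \<Longrightarrow> vf_scale c X \<in> vf_supp P"
  by (auto simp: vf_supp_def in_keys_iff lookup_vf_scale)

lemma vf_supp_sum: "(\<And>x. x \<in> A \<Longrightarrow> f x \<in> vf_supp P) \<Longrightarrow> sum f A \<in> vf_supp P"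
  by (induction A rule: infinite_finite_induct) (auto intro: vf_supp_add)

lemma vf_supp_mono: "X \<in> vf_supp P \<Longrightarrow> (\<And>j a. P j a \<Longrightarrow> Q j a) \<Longrightarrow> X \<in> vf_supp Q"
  by (auto simp: vf_supp_def)

lemma vf_UNIV: "X \<in> vf_supp (\<lambda>_ _. True)"
  by (simp add: vf_supp_def)

lemma vf_scale_vmon [simp]: "vf_scale c (vmon j a c') = vmon j a (c * c')"
  by (rule vfield_eqI) (simp add: lookup_vf_scale lookup_single when_def)

lemma vf_comp_scale_left: "vf_comp J (vf_scale c X) Y = vf_scale c (vf_comp J X Y)"
proof (induction rule: vf_supp_induct[OF vf_UNIV[of X]])
  case (2 X X')
  then show ?case by (simp add: vf_comp_add_left vf.scale_right_distrib)
next
  case (3 j a d)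
  show ?case
  proof (induction rule: vf_supp_induct[OF vf_UNIV[of Y]])
    case (2 Y Y')
    then show ?case by (simp add: vf_comp_add_right vf.scale_right_distrib)
  qed (simp_all add: vf_comp_vmon mult_ac)
qed simp

lemma vf_comp_scale_right: "vf_comp J X (vf_scale c Y) = vf_scale c (vf_comp J X Y)"
proof (induction rule: vf_supp_induct[OF vf_UNIV[of X]])
  case (2 X X')
  then show ?case by (simp add: vf_comp_add_left vf.scale_right_distrib)
next
  case (3 j a d)
  show ?case
  proof (induction rule: vf_supp_induct[OF vf_UNIV[of Y]])
    case (2 Y Y')
    then show ?case by (simp add: vf_comp_add_right vf.scale_right_distrib)
  qed (simp_all add: vf_comp_vmon mult_ac)
qed simp

section \<open>Parity components and the bracket\<close>

lemma lookup_vf_part: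
  "lookup (lookup (vf_part J p X) j) a = (if term_odd J a j = p then lookup (lookup X j) a else 0)"
proof -
  have "vf_part J p X = (\<Sum>j\<in>keys X. \<Sum>a\<in>keys (lookup X j).
      if term_odd J a j = p then vmon j a (lookup (lookup X j) a) else 0)"
    unfolding vf_part_def by (intro sum.cong refl sum.inter_filter) simp
  also have "\<dots> = (\<Sum>j\<in>keys X. Poly_Mapping.single j (\<Sum>a\<in>keys (lookup X j).
      Poly_Mapping.single a (if term_odd J a j = p then lookup (lookup X j) a else 0)))"
    unfolding single_sum by (intro sum.cong refl) simp
  finally show ?thesis
    by (auto simp: lookup_sum lookup_single when_def in_keys_iff)
qed

lemma vf_part_add: "vf_part J p (X + Y) = vf_part J p X + vf_part J p Y"
  by (rule vfield_eqI) (simp add: lookup_vf_part lookup_add)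

lemma vf_part_zero [simp]: "vf_part J p 0 = 0"
  by (rule vfield_eqI) (simp add: lookup_vf_part)

lemma vf_part_scale: "vf_part J p (vf_scale c X) = vf_scale c (vf_part J p X)"
  by (rule vfield_eqI) (simp add: lookup_vf_part lookup_vf_scale)

lemma vf_part_vmon: "vf_part J p (vmon j a c) = (if term_odd J a j = p then vmon j a c else 0)"
  by (rule vfield_eqI) (auto simp: lookup_vf_part lookup_single when_def)

lemma vf_part_hom:
  assumes "X \<in> vf_supp (\<lambda>j a. term_odd J a j = q)"
  shows "vf_part J p X = (if p = q then X else 0)"
  using assms by (intro vfield_eqI) (force simp: lookup_vf_part vf_supp_def in_keys_iff)

lemma vf_part_supp: "X \<in> vf_supp P \<Longrightarrow> vf_part J p X \<in> vf_supp P"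
  by (auto simp: vf_supp_def in_keys_iff lookup_vf_part split: if_splits)

lemma signed_add: "signed b (x + y) = signed b x + (signed b y :: 'a::ab_group_add)"
  by (simp add: signed_def)

lemma signed_zero [simp]: "signed b 0 = (0 :: 'a::ab_group_add)"
  by (simp add: signed_def)

lemma vf_scale_signed: "vf_scale c (signed b X) = signed b (vf_scale c X)"
  by (simp add: signed_def vf.scale_minus_right)

lemma vf_bracket_add_left: "vf_bracket J (X + X') Y = vf_bracket J X Y + vf_bracket J X' Y"
  by (simp add: vf_bracket_def UNIV_bool vf_part_add vf_comp_add_left vf_comp_add_right signed_add)

lemma vf_bracket_add_right: "vf_bracket J X (Y + Y') = vf_bracket J X Y + vf_bracket J X Y'"
  by (simp add: vf_bracket_def UNIV_bool vf_part_add vf_comp_add_left vf_comp_add_right signed_add)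

lemma vf_bracket_zero [simp]: "vf_bracket J 0 Y = 0" "vf_bracket J X 0 = 0"
  by (simp_all add: vf_bracket_def)

lemma vf_bracket_scale_left: "vf_bracket J (vf_scale c X) Y = vf_scale c (vf_bracket J X Y)"
  by (simp add: vf_bracket_def UNIV_bool vf_part_scale vf_comp_scale_left vf_comp_scale_right
    vf.scale_right_distrib vf.scale_right_diff_distrib vf_scale_signed)

lemma vf_bracket_scale_right: "vf_bracket J X (vf_scale c Y) = vf_scale c (vf_bracket J X Y)"
  by (simp add: vf_bracket_def UNIV_bool vf_part_scale vf_comp_scale_left vf_comp_scale_right
    vf.scale_right_distrib vf.scale_right_diff_distrib vf_scale_signed)

lemma vf_bracket_sum_left: "vf_bracket J (sum f A) Y = (\<Sum>x\<in>A. vf_bracket J (f x) Y)"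
  by (induction A rule: infinite_finite_induct) (simp_all add: vf_bracket_add_left)

lemma vf_bracket_sum_right: "vf_bracket J X (sum f A) = (\<Sum>x\<in>A. vf_bracket J X (f x))"
  by (induction A rule: infinite_finite_induct) (simp_all add: vf_bracket_add_right)

lemma vf_comp_sum_left: "vf_comp J (sum f A) Y = (\<Sum>x\<in>A. vf_comp J (f x) Y)"
  by (induction A rule: infinite_finite_induct) (simp_all add: vf_comp_add_left)

lemma vf_comp_sum_right: "vf_comp J X (sum f A) = (\<Sum>x\<in>A. vf_comp J X (f x))"
  by (induction A rule: infinite_finite_induct) (simp_all add: vf_comp_add_right)

text \<open>Of the four summands of the bracket only the one for the parities of \<open>X\<close>
  and \<open>Y\<close> survives.\<close>

lemma vf_bracket_hom:
  assumes "X \<in> vf_supp (\<lambda>j a. term_odd J a j = p)" "Y \<in> vf_supp (\<lambda>j a. term_odd J a j = q)"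
  shows "vf_bracket J X Y = vf_comp J X Y - signed (p \<and> q) (vf_comp J Y X)"
  by (cases p; cases q)
    (simp_all add: vf_bracket_def UNIV_bool vf_part_hom[OF assms(1)] vf_part_hom[OF assms(2)])

text \<open>With one even argument no sign occurs in the bracket, so it is antisymmetric for
  \<open>Y\<close> of mixed parity as well.\<close>

lemma vf_bracket_antisym_even:
  assumes "X \<in> vf_supp (\<lambda>j a. term_odd J a j = False)"
  shows "vf_bracket J Y X = - vf_bracket J X Y"
  by (simp add: vf_bracket_def UNIV_bool vf_part_hom[OF assms] signed_def)

section \<open>Multiplication by powers of one variable\<close>

text \<open>The product of functions here is the convolution product, not \<open>func_mult\<close>.\<close>
definition vf_times :: "'k::field func \<Rightarrow> 'k vfield \<Rightarrow> 'k vfield" where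
  "vf_times u X = Poly_Mapping.map ((*) u) X"

lemma lookup_vf_times: "lookup (vf_times u X) j = u * lookup X j"
  by (simp add: vf_times_def Poly_Mapping.map.rep_eq when_def)

lemma vf_times_zero [simp]: "vf_times u 0 = 0" "vf_times 0 X = 0"
  by (rule poly_mapping_eqI; simp add: lookup_vf_times)+

lemma vf_times_add_right: "vf_times u (X + Y) = vf_times u X + vf_times u Y"
  by (rule poly_mapping_eqI) (simp add: lookup_vf_times lookup_add distrib_left)

lemma vf_times_diff_right: "vf_times u (X - Y) = vf_times u X - vf_times u Y"
  by (rule poly_mapping_eqI) (simp add: lookup_vf_times lookup_minus right_diff_distrib)

lemma vf_times_uminus_right: "vf_times u (- X) = - vf_times u X"
  by (rule poly_mapping_eqI) (simp add: lookup_vf_times)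

lemma vf_times_signed: "vf_times u (signed b X) = signed b (vf_times u X)"
  by (simp add: signed_def vf_times_uminus_right)

lemma vf_times_sum_right: "vf_times u (sum f A) = (\<Sum>x\<in>A. vf_times u (f x))"
  by (induction A rule: infinite_finite_induct) (simp_all add: vf_times_add_right)

lemma vf_times_one [simp]: "vf_times 1 X = X"
  by (rule poly_mapping_eqI) (simp add: lookup_vf_times)

lemma vf_times_vmon:
  "vf_times (Poly_Mapping.single m g) (vmon j a c) = vmon j (m + a) (g * c)"
  by (rule poly_mapping_eqI) (auto simp: lookup_vf_times lookup_single when_def mult_single)

lemma vf_times_scale: "vf_times u (vf_scale c X) = vf_scale c (vf_times u X)"
  by (rule poly_mapping_eqI)
    (simp add: lookup_vf_times vf_scale_def Poly_Mapping.map.rep_eq mult_map_scale_conv_mult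
      mult.left_commute when_def)

text \<open>
  The divided power of \<open>x\<^sub>i\<close>: in characteristic 0 the monomial \<open>single i k\<close> stands for the
  ordinary power, hence the factor \<open>1/k!\<close>.
\<close>
definition dpow :: "nat \<Rightarrow> nat \<Rightarrow> 'k::field func" where
  "dpow i k = Poly_Mapping.single (Poly_Mapping.single i k) (if CHAR('k) = 0 then inverse (of_nat (fact k)) else 1)"

lemma dpow_0 [simp]: "dpow i 0 = 1"
  by (simp add: dpow_def)

text \<open>Convolution adds exponents without any coefficient. In characteristic 0 the binomial
  coefficient comes from \<open>1/(k! l!)\<close>; in positive characteristic the monomial is the
  divided power itself, and the coefficient is left to \<open>even_coeff\<close>.\<close>

lemma dpow_mult:
  "dpow i k * dpow i l = Poly_Mapping.map ((*) (if CHAR('k) = 0 then of_nat ((k + l) choose k) else 1)) (dpow i (k + l) :: 'k::field func)"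
proof (cases "CHAR('k) = 0")
  case True
  have nz: "of_nat (fact m) \<noteq> (0::'k)" for m
    using True by (simp add: of_nat_eq_0_iff_char_dvd)
  have "of_nat ((k + l) choose k) * (of_nat (fact k) * of_nat (fact l)) = (of_nat (fact (k + l)) :: 'k)"
    using binomial_fact_lemma[of k "k + l"] by (simp add: mult_ac flip: of_nat_mult)
  then have "inverse (of_nat (fact k)) * inverse (of_nat (fact l)) =
      of_nat ((k + l) choose k) * inverse (of_nat (fact (k + l)) :: 'k)"
    using nz by (simp add: field_simps del: of_nat_fact)
  then show ?thesis
    using True by (simp add: dpow_def mult_single single_add[symmetric] del: of_nat_fact)
next
  case False
  then show ?thesis by (simp add: dpow_def mult_single single_add[symmetric])
qed

text \<open>The binomial coefficient enters exactly once: in characteristic 0 through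
  \<open>dpow_mult\<close>, in positive characteristic through \<open>even_coeff\<close>. This gives
  one product rule for divided powers in all characteristics.\<close>

lemma even_coeff_dpow:
  "vf_scale (even_coeff k l) (vf_times (dpow i k) (vf_times (dpow i l) X)) =
   vf_scale (of_nat ((k + l) choose k)) (vf_times (dpow i (k + l)) (X :: 'k::field vfield))"
proof -
  have "vf_times (dpow i k) (vf_times (dpow i l) X) =
    vf_scale (if CHAR('k) = 0 then of_nat ((k + l) choose k) else 1) (vf_times (dpow i (k + l)) X)"
    by (rule poly_mapping_eqI)
      (simp add: lookup_vf_times vf_scale_def Poly_Mapping.map.rep_eq when_def
        mult.assoc[symmetric] dpow_mult mult_map_scale_conv_mult)
  then show ?thesis by (simp add: even_coeff_def)
qed

text \<open>Terms that neither contain \<open>x\<^sub>i\<close> nor differentiate along it. The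
  bound on odd exponents keeps \<open>monom_coeff J 0 a\<close> equal to 1; it is 0 on exponent
  vectors that stand for no monomial.\<close>

definition free_of :: "nat set \<Rightarrow> nat \<Rightarrow> nat \<Rightarrow> monom \<Rightarrow> bool" where
  "free_of J i j a \<longleftrightarrow> i \<noteq> j \<and> lookup a i = 0 \<and> (\<forall>l\<in>J. lookup a l \<le> 1)"

subsection \<open>Even variables\<close>

lemma monom_coeff_even:
  assumes "i \<notin> J" "lookup a i = 0" "lookup b i = 0"
  shows "monom_coeff J (Poly_Mapping.single i k + a) (Poly_Mapping.single i l + b) =
    even_coeff k l * (monom_coeff J a b :: 'k::field)"
proof -
  have look: "lookup (Poly_Mapping.single i k + a) x = (if x = i then k else lookup a x)"
    "lookup (Poly_Mapping.single i l + b) x = (if x = i then l else lookup b x)" for x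
    using assms by (auto simp: lookup_add lookup_single when_def)
  have keys: "J \<inter> keys (Poly_Mapping.single i k + a) = J \<inter> keys a"
    "J \<inter> keys (Poly_Mapping.single i l + b) = J \<inter> keys b"
    using assms(1) by (auto simp: in_keys_iff look split: if_splits)
  have nJ: "lookup (Poly_Mapping.single i k + a) x = lookup a x"
    "lookup (Poly_Mapping.single i l + b) x = lookup b x" if "x \<in> J" for x
    using that assms(1) by (auto simp: look)
  \<comment> \<open>For \<open>k = 0\<close> the index \<open>i\<close> is not a key, but its factor
    \<open>even_coeff 0 l\<close> is 1.\<close>
  have "(\<Prod>x\<in>keys (Poly_Mapping.single i k + a) - J. even_coeff (lookup (Poly_Mapping.single i k + a) x)
      (lookup (Poly_Mapping.single i l + b) x)) =
    (\<Prod>x\<in>insert i (keys a - J). even_coeff (if x = i then k else lookup a x)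
      (if x = i then l else lookup b x) :: 'k)"
    by (intro prod.mono_neutral_cong_left)
      (use assms(1,2) in \<open>auto simp: in_keys_iff look even_coeff_def split: if_splits\<close>)
  also have "\<dots> = even_coeff k l * (\<Prod>x\<in>keys a - J. even_coeff (lookup a x) (lookup b x))"
    using assms by (subst prod.insert) (auto simp: in_keys_iff intro!: prod.cong)
  finally show ?thesis
    by (simp add: monom_coeff_def keys nJ cong: bex_cong)
qed

lemma deriv_coeff_even:
  assumes "i \<notin> J" "i \<noteq> j"
  shows "deriv_coeff J j (Poly_Mapping.single i l + b) = deriv_coeff J j b"
proof -
  have "{x \<in> J \<inter> keys (Poly_Mapping.single i l + b). x < j} = {x \<in> J \<inter> keys b. x < j}"
    using assms by (auto simp: in_keys_iff lookup_add lookup_single when_def)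
  then show ?thesis using assms by (simp add: deriv_coeff_def lookup_add lookup_single when_def)
qed

lemma single_add_minus_single:
  assumes "i \<noteq> j"
  shows "Poly_Mapping.single i l + b - Poly_Mapping.single j (m::nat) =
    Poly_Mapping.single i l + (b - Poly_Mapping.single j m)"
  using assms by (intro poly_mapping_eqI) (auto simp: lookup_add lookup_minus lookup_single when_def)

text \<open>\<open>A\<close> has no component along \<open>\<partial>\<^sub>i\<close>, so it does
  not differentiate the power of \<open>x\<^sub>i\<close>, and an even variable passes
  \<open>A\<close> without a sign. The two powers are merely multiplied.\<close>

lemma vf_comp_dpow_dpow:
  assumes i: "i \<notin> J" and A: "A \<in> vf_supp (free_of J i)" and B: "B \<in> vf_supp (free_of J i)"
  shows "vf_comp J (vf_times (dpow i k) A) (vf_times (dpow i l) B) =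
    vf_scale (of_nat ((k + l) choose k)) (vf_times (dpow i (k + l)) (vf_comp J A B))"
  \<comment> \<open>In this form the right-hand side carries the factor
    \<open>even_coeff k l\<close> that \<open>monom_coeff\<close> yields on terms.\<close>
  unfolding even_coeff_dpow[symmetric]
  using A
proof (induction rule: vf_supp_induct)
  case (add X Y)
  then show ?case by (simp add: vf_times_add_right vf_comp_add_left vf.scale_right_distrib)
next
  case (vmon x a c)
  note x = vmon
  show ?case using B
  proof (induction rule: vf_supp_induct)
    case (add X Y)
    then show ?case by (simp add: vf_times_add_right vf_comp_add_right vf.scale_right_distrib)
  next
    case (vmon y b c')
    have "lookup (b - Poly_Mapping.single x 1) i = 0"
      using vmon by (simp add: free_of_def lookup_minus)
    then show ?case
      using x vmon i
      by (auto simp: dpow_def vf_times_vmon vf_comp_vmon free_of_def lookup_add lookup_single when_def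
         single_add_minus_single monom_coeff_even deriv_coeff_even)
        (simp_all add: ac_simps)
  qed simp
qed simp

lemma vf_comp_partial_dpow:
  assumes i: "i \<notin> J" and B: "B \<in> vf_supp (free_of J i)"
  shows "vf_comp J (vf_partial i) (vf_times (dpow i (Suc k)) B) = vf_times (dpow i k) B"
  using B
proof (induction rule: vf_supp_induct)
  case (add X Y)
  then show ?case by (simp add: vf_times_add_right vf_comp_add_right)
next
  case (vmon y b c)
  have eq: "Poly_Mapping.single i (Suc k) + b - Poly_Mapping.single i (Suc 0) = Poly_Mapping.single i k + b"
    by (intro poly_mapping_eqI) (auto simp: lookup_add lookup_minus lookup_single when_def)
  have one: "monom_coeff J 0 (Poly_Mapping.single i k + b) = (1::'a)"
    using vmon i by (auto simp: monom_coeff_def free_of_def lookup_add lookup_single when_def)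
  \<comment> \<open>In characteristic 0 the derivative of \<open>x^(k+1)/(k+1)!\<close> is
    \<open>x^k/k!\<close>; otherwise \<open>deriv_coeff\<close> is 1 and the divided power is just
    lowered.\<close>
  have "of_nat (Suc k) * inverse (of_nat (fact (Suc k))) = inverse (of_nat (fact k) :: 'a)"
    if "CHAR('a) = 0"
  proof -
    have "of_nat (Suc k) \<noteq> (0::'a)"
      using that by (metis of_nat_eq_0_iff_char_dvd dvd_0_left_iff nat.distinct(1))
    moreover have "of_nat (fact (Suc k)) = of_nat (Suc k) * (of_nat (fact k) :: 'a)"
      by (simp only: fact_Suc of_nat_mult of_nat_id)
    ultimately show ?thesis
      by (simp del: of_nat_Suc of_nat_fact fact_Suc)
  qed
  then show ?case
    using vmon i
    by (auto simp: vf_partial_def dpow_def vf_times_vmon vf_comp_vmon lookup_add eq one deriv_coeff_def free_of_def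
         mult.assoc[symmetric] simp del: of_nat_Suc single_one fact_Suc of_nat_fact)
qed simp

lemma vf_comp_partial_free:
  assumes "B \<in> vf_supp (free_of J i)"
  shows "vf_comp J (vf_partial i) B = 0"
  using assms
  by (induction rule: vf_supp_induct)
    (auto simp: vf_comp_add_right vf_partial_def vf_comp_vmon free_of_def simp del: single_one)

text \<open>The coefficients of \<open>\<partial>\<^sub>i\<close> are constants, which every field
  annihilates.\<close>

lemma vf_comp_to_partial: "vf_comp J X (vf_partial i) = 0"
  by (induction rule: vf_supp_induct[OF vf_UNIV[of X]])
    (auto simp: vf_comp_add_left vf_partial_def vf_comp_vmon simp del: single_one)

lemma term_odd_even_var:
  assumes "i \<notin> J"
  shows "term_odd J (Poly_Mapping.single i k + a) j = term_odd J a j"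
proof -
  have "J \<inter> keys (Poly_Mapping.single i k + a) = J \<inter> keys a"
    using assms by (auto simp: in_keys_iff lookup_add lookup_single when_def split: if_splits)
  moreover have "lookup (Poly_Mapping.single i k + a) x = lookup a x" if "x \<in> J" for x
    using that assms by (auto simp: lookup_add lookup_single when_def)
  ultimately show ?thesis by (simp add: term_odd_def)
qed

lemma vf_part_times_dpow:
  assumes "i \<notin> J"
  shows "vf_part J p (vf_times (dpow i k) X) = vf_times (dpow i k) (vf_part J p X)"
  by (induction rule: vf_supp_induct[OF vf_UNIV[of X]])
    (auto simp: vf_times_add_right vf_part_add dpow_def vf_times_vmon vf_part_vmon
      term_odd_even_var[OF assms])

lemma vf_bracket_dpow_dpow:
  assumes i: "i \<notin> J" and A: "A \<in> vf_supp (free_of J i)" and B: "B \<in> vf_supp (free_of J i)"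
  shows "vf_bracket J (vf_times (dpow i k) A) (vf_times (dpow i l) B) =
    vf_scale (of_nat ((k + l) choose k)) (vf_times (dpow i (k + l)) (vf_bracket J A B))"
proof -
  \<comment> \<open>The second half of the bracket, with the factors exchanged, produces
    \<open>(l + k) choose l\<close>.\<close>
  have sym: "(k + l) choose l = (k + l) choose k"
    by (metis add_diff_cancel_left' binomial_symmetric le_add1)
  show ?thesis
    by (simp add: vf_bracket_def UNIV_bool vf_part_times_dpow[OF i]
      vf_comp_dpow_dpow[OF i] vf_part_supp A B sym add.commute[of l k] vf_scale_signed vf_times_signed
      vf.scale_right_distrib vf.scale_right_diff_distrib vf_times_add_right vf_times_diff_right)
qed

subsection \<open>Odd variables\<close>

text \<open>
  The new variable has the smallest index, so multiplication by it from the left causes no sign.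
\<close>
definition free_below :: "nat set \<Rightarrow> nat \<Rightarrow> nat \<Rightarrow> monom \<Rightarrow> bool" where
  "free_below J i j a \<longleftrightarrow> i < j \<and> keys a \<subseteq> {i<..} \<and> (\<forall>l\<in>J. lookup a l \<le> 1)"

lemma free_below_imp_free_of: "free_below J i j a \<Longrightarrow> free_of J i j a"
  by (auto simp: free_below_def free_of_def in_keys_iff subset_iff)

lemma lookup_eq_0_below:
  assumes "keys a \<subseteq> {i<..}" "l \<le> i"
  shows "lookup (a :: monom) l = 0"
proof -
  have "l \<notin> keys a" using assms by auto
  then show ?thesis by (simp add: in_keys_iff)
qed

lemma keys_single_add:
  "keys (Poly_Mapping.single (i::nat) (Suc 0) + b) = insert i (keys b)"
  by (auto simp: in_keys_iff lookup_add lookup_single when_def split: if_splits)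

lemma term_odd_odd_var:
  assumes "i \<in> J" "lookup a i = 0"
  shows "term_odd J (Poly_Mapping.single i (Suc 0) + a) j = (\<not> term_odd J a j)"
proof -
  have "(\<Sum>x\<in>J \<inter> keys (Poly_Mapping.single i (Suc 0) + a). lookup (Poly_Mapping.single i (Suc 0) + a) x) =
    (\<Sum>x\<in>insert i (J \<inter> keys a). lookup (Poly_Mapping.single i (Suc 0) + a) x)"
    using assms(1) unfolding keys_single_add by (intro sum.cong) auto
  also have "\<dots> = Suc (\<Sum>x\<in>J \<inter> keys a. lookup (Poly_Mapping.single i (Suc 0) + a) x)"
    using assms(2) by (subst sum.insert) (auto simp: in_keys_iff lookup_add)
  also have "(\<Sum>x\<in>J \<inter> keys a. lookup (Poly_Mapping.single i (Suc 0) + a) x) = (\<Sum>x\<in>J \<inter> keys a. lookup a x)"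
    using assms(2) by (intro sum.cong) (auto simp: lookup_add lookup_single when_def in_keys_iff)
  finally show ?thesis by (auto simp: term_odd_def)
qed

lemma monom_coeff_odd_left:
  assumes "keys a \<subseteq> {i<..}" "keys b \<subseteq> {i<..}" "i \<in> J"
  shows "monom_coeff J (Poly_Mapping.single i (Suc 0) + a) b = (monom_coeff J a b :: 'k::field)"
proof -
  have look: "lookup (Poly_Mapping.single i (Suc 0) + a) x = (if x = i then Suc 0 else lookup a x)" for x
    using assms by (auto simp: lookup_add lookup_single when_def lookup_eq_0_below)
  have c: "(\<exists>x\<in>J. 1 < lookup (Poly_Mapping.single i (Suc 0) + a) x + lookup b x) \<longleftrightarrow>
    (\<exists>x\<in>J. 1 < lookup a x + lookup b x)"
    by (intro bex_cong refl) (use assms in \<open>auto simp: look lookup_eq_0_below\<close>)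
  have s: "{(x, y). x \<in> J \<inter> keys (Poly_Mapping.single i (Suc 0) + a) \<and> y \<in> J \<inter> keys b \<and> y < x} =
    {(x, y). x \<in> J \<inter> keys a \<and> y \<in> J \<inter> keys b \<and> y < x}"
    using assms unfolding keys_single_add by (auto simp: subset_iff)
  have p: "(\<Prod>x\<in>keys (Poly_Mapping.single i (Suc 0) + a) - J.
      even_coeff (lookup (Poly_Mapping.single i (Suc 0) + a) x) (lookup b x)) =
    (\<Prod>x\<in>keys a - J. even_coeff (lookup a x) (lookup b x) :: 'k)"
    unfolding keys_single_add using assms(3) by (intro prod.cong) (auto simp: look)
  show ?thesis unfolding monom_coeff_def c s p ..
qed

text \<open>Sorting moves \<open>x\<^sub>i\<close> to the front past each odd variable
  \<open>l\<close> of \<open>a\<close>, which adds the inversions \<open>(l, i)\<close>.\<close>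

lemma monom_coeff_odd_right:
  assumes "keys a \<subseteq> {i<..}" "keys b \<subseteq> {i<..}" "i \<in> J"
  shows "monom_coeff J a (Poly_Mapping.single i (Suc 0) + b) =
    (-1) ^ card (J \<inter> keys a) * (monom_coeff J a b :: 'k::field)"
proof -
  have look: "lookup (Poly_Mapping.single i (Suc 0) + b) x = (if x = i then Suc 0 else lookup b x)" for x
    using assms by (auto simp: lookup_add lookup_single when_def lookup_eq_0_below)
  have c: "(\<exists>x\<in>J. 1 < lookup a x + lookup (Poly_Mapping.single i (Suc 0) + b) x) \<longleftrightarrow>
    (\<exists>x\<in>J. 1 < lookup a x + lookup b x)"
    by (intro bex_cong refl) (use assms in \<open>auto simp: look lookup_eq_0_below\<close>)
  let ?S = "{(x, y). x \<in> J \<inter> keys a \<and> y \<in> J \<inter> keys b \<and> y < x}"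
  have s: "{(x, y). x \<in> J \<inter> keys a \<and> y \<in> J \<inter> keys (Poly_Mapping.single i (Suc 0) + b) \<and> y < x} =
    (\<lambda>x. (x, i)) ` (J \<inter> keys a) \<union> ?S"
    using assms unfolding keys_single_add by (auto simp: subset_iff)
  have "finite ?S"
    by (rule finite_subset[of _ "keys a \<times> keys b"]) auto
  then have "card ((\<lambda>x. (x, i)) ` (J \<inter> keys a) \<union> ?S) = card (J \<inter> keys a) + card ?S"
    using assms(2) by (subst card_Un_disjoint) (auto simp: card_image inj_on_def)
  moreover have p: "(\<Prod>x\<in>keys a - J. even_coeff (lookup a x) (lookup (Poly_Mapping.single i (Suc 0) + b) x)) =
    (\<Prod>x\<in>keys a - J. even_coeff (lookup a x) (lookup b x) :: 'k)"
    using assms(3) by (intro prod.cong) (auto simp: look)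
  ultimately show ?thesis unfolding monom_coeff_def c s p by (simp add: power_add)
qed

lemma monom_coeff_odd_both:
  assumes "i \<in> J"
  shows "monom_coeff J (Poly_Mapping.single i (Suc 0) + a) (Poly_Mapping.single i (Suc 0) + b) = 0"
proof -
  have "1 < lookup (Poly_Mapping.single i (Suc 0) + a) i + lookup (Poly_Mapping.single i (Suc 0) + b) i"
    by (simp add: lookup_add)
  with assms show ?thesis unfolding monom_coeff_def by (simp only: if_P bexI[of _ i])
qed

text \<open>\<open>x\<^sub>i\<close> precedes all variables of \<open>b\<close>, so an odd
  \<open>\<partial>\<^sub>j\<close> has one more odd variable to pass.\<close>

lemma deriv_coeff_odd:
  assumes "i \<in> J" "i < j" "keys b \<subseteq> {i<..}"
  shows "deriv_coeff J j (Poly_Mapping.single i (Suc 0) + b) =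
    (if j \<in> J then - 1 else 1) * (deriv_coeff J j b :: 'k::field)"
proof -
  have "{x \<in> J \<inter> keys (Poly_Mapping.single i (Suc 0) + b). x < j} = insert i {x \<in> J \<inter> keys b. x < j}"
    using assms unfolding keys_single_add by auto
  moreover have "i \<notin> {x \<in> J \<inter> keys b. x < j}" using assms(3) by auto
  ultimately show ?thesis
    using assms(2) by (simp add: deriv_coeff_def lookup_add lookup_single when_def)
qed

lemma dpow_Suc_0: "dpow i (Suc 0) = Poly_Mapping.single (Poly_Mapping.single i (Suc 0)) 1"
  by (simp add: dpow_def)

lemma vf_comp_xi_left:
  assumes i: "i \<in> J" and A: "A \<in> vf_supp (free_below J i)" and B: "B \<in> vf_supp (free_below J i)"
  shows "vf_comp J (vf_times (dpow i (Suc 0)) A) B = vf_times (dpow i (Suc 0)) (vf_comp J A B)"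
  using A
proof (induction rule: vf_supp_induct)
  case (add X Y)
  then show ?case by (simp add: vf_times_add_right vf_comp_add_left)
next
  case (vmon x a c)
  note x = vmon
  show ?case using B
  proof (induction rule: vf_supp_induct)
    case (add X Y)
    then show ?case by (simp add: vf_times_add_right vf_comp_add_right)
  next
    case (vmon y b c')
    have "keys (b - Poly_Mapping.single x (Suc 0)) \<subseteq> keys b"
      by (auto simp: in_keys_iff lookup_minus)
    then have "keys (b - Poly_Mapping.single x (Suc 0)) \<subseteq> {i<..}"
      using vmon by (auto simp: free_below_def)
    then show ?case
      using x vmon i
      by (auto simp: dpow_Suc_0 vf_times_vmon vf_comp_vmon free_below_def monom_coeff_odd_left)
        (simp add: ac_simps)
  qed simp
qed simp

text \<open>On a term \<open>x^a \<partial>\<^sub>j\<close> of \<open>A\<close>, moving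
  \<open>x\<^sub>i\<close> past \<open>x^a\<close> costs the sign of the parity of
  \<open>x^a\<close>, and moving it past \<open>\<partial>\<^sub>j\<close> that of the parity of
  \<open>\<partial>\<^sub>j\<close>. The product is the sign of the parity \<open>p\<close> of
  \<open>A\<close>.\<close>

lemma vf_comp_xi_right:
  assumes i: "i \<in> J" and A: "A \<in> vf_supp (\<lambda>j a. free_below J i j a \<and> term_odd J a j = p)"
    and B: "B \<in> vf_supp (free_below J i)"
  shows "vf_comp J A (vf_times (dpow i (Suc 0)) B) = signed p (vf_times (dpow i (Suc 0)) (vf_comp J A B))"
  using A
proof (induction rule: vf_supp_induct)
  case (add X Y)
  then show ?case by (simp add: vf_times_add_right vf_comp_add_left signed_add)
next
  case (vmon x a c)
  note x = vmon
  show ?case using B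
  proof (induction rule: vf_supp_induct)
    case (add X Y)
    then show ?case by (simp add: vf_times_add_right vf_comp_add_right signed_add)
  next
    case (vmon y b c')
    have "keys (b - Poly_Mapping.single x (Suc 0)) \<subseteq> keys b"
      by (auto simp: in_keys_iff lookup_minus)
    then have k: "keys (b - Poly_Mapping.single x (Suc 0)) \<subseteq> {i<..}"
      using vmon by (auto simp: free_below_def)
    \<comment> \<open>Odd exponents are at most 1, so the degree in the odd variables is the number
      of odd keys.\<close>
    have "(\<Sum>l\<in>J \<inter> keys a. lookup a l) = (\<Sum>l\<in>J \<inter> keys a. 1)"
      using x by (intro sum.cong) (auto simp: free_below_def in_keys_iff intro: le_antisym)
    then have p: "p \<longleftrightarrow> odd (card (J \<inter> keys a)) \<noteq> (x \<in> J)"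
      using x by (auto simp: term_odd_def)
    have sgn: "vmon y m (- d) = - vmon y m d" for m and d :: 'a
      by (simp add: single_uminus)
    have ix: "i \<noteq> x" "i < x" using x by (auto simp: free_below_def)
    show ?case
      using x vmon i ix k
      by (cases "x \<in> J"; cases "odd (card (J \<inter> keys a))";
        auto simp: dpow_Suc_0 vf_times_vmon vf_comp_vmon free_below_def lookup_add lookup_single when_def
          single_add_minus_single monom_coeff_odd_right
          deriv_coeff_odd p signed_def sgn)
        (simp_all add: ac_simps)
  qed simp
qed simp

text \<open>\<open>A\<close> does not differentiate \<open>x\<^sub>i\<close>, so both factors
  \<open>x\<^sub>i\<close> survive, and the square of an odd variable is 0.\<close>

lemma vf_comp_xi_xi:
  assumes i: "i \<in> J" and A: "A \<in> vf_supp (free_below J i)"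
    and B: "B \<in> vf_supp (free_below J i)"
  shows "vf_comp J (vf_times (dpow i (Suc 0)) A) (vf_times (dpow i (Suc 0)) B) = 0"
  using A
proof (induction rule: vf_supp_induct)
  case (add X Y)
  then show ?case by (simp add: vf_times_add_right vf_comp_add_left signed_add)
next
  case (vmon x a c)
  note x = vmon
  show ?case using B
  proof (induction rule: vf_supp_induct)
    case (add X Y)
    then show ?case by (simp add: vf_times_add_right vf_comp_add_right signed_add)
  next
    case (vmon y b c')
    show ?case
      using x i
      by (auto simp: dpow_Suc_0 vf_times_vmon vf_comp_vmon free_below_def
          single_add_minus_single monom_coeff_odd_both)
  qed simp
qed simp

text \<open>\<open>x\<^sub>i\<close> stands in front of every term, so
  \<open>\<partial>\<^sub>i\<close> removes it without a sign.\<close>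

lemma vf_comp_partial_xi:
  assumes i: "i \<in> J" and B: "B \<in> vf_supp (free_below J i)"
  shows "vf_comp J (vf_partial i) (vf_times (dpow i (Suc 0)) B) = B"
  using B
proof (induction rule: vf_supp_induct)
  case (add X Y)
  then show ?case by (simp add: vf_times_add_right vf_comp_add_right)
next
  case (vmon y b c)
  have eq: "Poly_Mapping.single i (Suc 0) + b - Poly_Mapping.single i (Suc 0) = b"
    by (intro poly_mapping_eqI) (auto simp: lookup_add lookup_minus lookup_single when_def)
  have one: "monom_coeff J 0 b = (1::'a)"
    using vmon by (auto simp: monom_coeff_def free_below_def)
  have "{l \<in> J \<inter> keys (Poly_Mapping.single i (Suc 0) + b). l < i} = {}"
    using vmon keys_single_add[of i b] by (auto simp: free_below_def)
  then have "deriv_coeff J i (Poly_Mapping.single i (Suc 0) + b) = (1::'a)"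
    using i by (simp only: deriv_coeff_def if_True card.empty power_0)
  then show ?case
    by (auto simp: vf_partial_def dpow_Suc_0 vf_times_vmon vf_comp_vmon lookup_add eq one simp del: single_one)
qed simp

section \<open>Realizations of nilpotent Lie superalgebras\<close>

text \<open>Pascal's rule, in the form of the induction step of the Leibniz rule.\<close>

lemma (in vector_space) sum_choose_Suc:
  "(\<Sum>k\<le>Suc m. scale (of_nat (Suc m choose k)) (g k (Suc m - k))) =
   (\<Sum>k\<le>m. scale (of_nat (m choose k)) (g (Suc k) (m - k) + g k (Suc m - k)))"
proof -
  have "(\<Sum>k\<le>Suc m. scale (of_nat (Suc m choose k)) (g k (Suc m - k))) =
    g 0 (Suc m) + (\<Sum>k\<le>m. scale (of_nat (m choose Suc k)) (g (Suc k) (m - k)))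
    + (\<Sum>k\<le>m. scale (of_nat (m choose k)) (g (Suc k) (m - k)))"
    by (simp add: sum.atMost_Suc_shift scale_left_distrib sum.distrib del: sum.atMost_Suc)
  also have "g 0 (Suc m) + (\<Sum>k\<le>m. scale (of_nat (m choose Suc k)) (g (Suc k) (m - k))) =
    (\<Sum>k\<le>Suc m. scale (of_nat (m choose k)) (g k (Suc m - k)))"
    by (simp add: sum.atMost_Suc_shift del: sum.atMost_Suc)
  also have "\<dots> = (\<Sum>k\<le>m. scale (of_nat (m choose k)) (g k (Suc m - k)))"
    by (simp add: binomial_eq_0)
  finally show ?thesis by (simp add: scale_right_distrib sum.distrib add.commute)
qed

text \<open>All nonzero values of \<open>g\<close> lie in the square of side \<open>n\<close>, which
  is contained in the triangle \<open>k + l \<le> 2*n\<close>. This is why the exponential series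
  below is cut off at \<open>2*n\<close>: a product of two series can be regrouped by total
  degree.\<close>

lemma sum_square_eq_sum_triangle:
  fixes g :: "nat \<Rightarrow> nat \<Rightarrow> 'a::comm_monoid_add"
  assumes "\<And>k l. k > n \<or> l > n \<Longrightarrow> g k l = 0"
  shows "(\<Sum>k\<le>2*n. \<Sum>l\<le>2*n. g k l) = (\<Sum>m\<le>2*n. \<Sum>k\<le>m. g k (m - k))"
proof -
  have "(\<Sum>k\<le>2*n. \<Sum>l\<le>2*n. g k l) = (\<Sum>(k,l)\<in>{..2*n}\<times>{..2*n}. g k l)"
    by (rule sum.cartesian_product)
  also have "\<dots> = (\<Sum>(k,l)\<in>{(k,l). k + l \<le> 2*n}. g k l)"
    by (rule sum.mono_neutral_right) (auto intro!: assms)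
  also have "\<dots> = (\<Sum>m\<le>2*n. \<Sum>k\<le>m. g k (m - k))"
    by (rule sum.triangle_reindex_eq)
  finally show ?thesis .
qed

lemma vf_times_supp:
  assumes "X \<in> vf_supp P" "\<And>j a. P j a \<Longrightarrow> Q j (Poly_Mapping.single i k + a)"
  shows "vf_times (dpow i k) X \<in> vf_supp Q"
  using assms(1)
  by (induction rule: vf_supp_induct)
    (auto simp: vf_times_add_right dpow_def vf_times_vmon vf_supp_vmon intro: vf_supp_add assms(2))

lemma lookup_vf_times_0:
  assumes "k > 0"
  shows "lookup (lookup (vf_times (dpow i k) X) j) 0 = 0"
proof (induction rule: vf_supp_induct[OF vf_UNIV[of X]])
  case (3 l a c)
  have "lookup (Poly_Mapping.single i k + a) i \<noteq> 0"
    using assms by (simp add: lookup_add)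
  then have "Poly_Mapping.single i k + a \<noteq> 0" by (metis lookup_zero)
  then show ?case by (auto simp: dpow_def vf_times_vmon lookup_single when_def)
qed (simp_all add: vf_times_add_right lookup_add)

text \<open>The situation in coordinates: \<open>co x j\<close> is the coordinate of
  \<open>x\<close> at \<open>e j\<close>, \<open>J\<close> holds the odd indices and
  \<open>wt j\<close> is the depth of \<open>e j\<close>. By \<open>br_e\<close> and
  \<open>sq_e\<close>, brackets and squares of basis vectors involve only later basis vectors and
  respect the grading. This triangular form suits an induction over the indices.\<close>

locale nilpotent_frame = lie_superalgebra scale br sq par
  for scale :: "'k::field \<Rightarrow> 'a::ab_group_add \<Rightarrow> 'a" and br sq par +
  fixes n :: nat and e :: "nat \<Rightarrow> 'a" and J :: "nat set" and wt :: "nat \<Rightarrow> nat"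
    and co :: "'a \<Rightarrow> nat \<Rightarrow> 'k"
  assumes J: "J \<subseteq> {1..n}"
    and co_add: "co (x + y) j = co x j + co y j"
    and co_scale: "co (scale c x) j = c * co x j"
    and co_e: "i \<in> {1..n} \<Longrightarrow> co (e i) j = (if i = j then 1 else 0)"
    and co_out: "j \<notin> {1..n} \<Longrightarrow> co x j = 0"
    and expand: "x = (\<Sum>j\<in>{1..n}. scale (co x j) (e j))"
    and par_iff: "x \<in> par p \<longleftrightarrow> (\<forall>j. co x j \<noteq> 0 \<longrightarrow> (j \<in> J) = p)"
    and br_e: "\<lbrakk>j \<in> {1..n}; k \<in> {1..n}; co (br (e j) (e k)) l \<noteq> 0\<rbrakk> \<Longrightarrow> j < l \<and> k < l \<and> wt l = wt j + wt k"
    and sq_e: "\<lbrakk>CHAR('k) = 2; j \<in> J; co (sq (e j)) l \<noteq> 0\<rbrakk> \<Longrightarrow> j < l \<and> wt l = 2 * wt j"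
begin

section \<open>Coordinates, and the ideals spanned by the last basis vectors\<close>

lemma br_hom: "module_hom scale scale (\<lambda>x. br x y)" "module_hom scale scale (br x)"
  using br_linear_left[of y] br_linear_right[of x] by (simp_all add: Vector_Spaces.linear_def)

lemma br_add_left: "br (x + y) z = br x z + br y z"
  and br_add_right: "br x (y + z) = br x y + br x z"
  and br_scale_left: "br (scale c x) y = scale c (br x y)"
  and br_scale_right: "br x (scale c y) = scale c (br x y)"
  and br_zero_left [simp]: "br 0 x = 0"
  and br_zero_right [simp]: "br x 0 = 0"
  and br_sum_left: "br (sum f A) x = (\<Sum>a\<in>A. br (f a) x)"
  and br_sum_right: "br x (sum f A) = (\<Sum>a\<in>A. br x (f a))"
  and br_uminus_right: "br x (- y) = - br x y"
  by (simp_all add: module_hom.add[OF br_hom(1)] module_hom.add[OF br_hom(2)]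
      module_hom.scale[OF br_hom(1)] module_hom.scale[OF br_hom(2)] module_hom.zero[OF br_hom(1)]
      module_hom.zero[OF br_hom(2)] module_hom.sum[OF br_hom(1)] module_hom.sum[OF br_hom(2)]
      module_hom.neg[OF br_hom(2)])

lemma co_zero [simp]: "co 0 j = 0"
  using co_scale[of 0 0 j] by simp

lemma co_sum: "co (sum f A) j = (\<Sum>a\<in>A. co (f a) j)"
  by (induction A rule: infinite_finite_induct) (simp_all add: co_add)

lemma co_eq_0: "(\<And>j. co x j = 0) \<Longrightarrow> x = 0"
  by (subst expand) simp

lemma e_par: "i \<in> {1..n} \<Longrightarrow> e i \<in> par (i \<in> J)"
  by (auto simp: par_iff co_e)

text \<open>The sign in \<open>super_jacobi\<close> is trivial for even \<open>x\<close>, so by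
  additivity \<open>br x\<close> is a derivation on vectors of mixed parity too.\<close>

lemma even_jacobi:
  assumes "x \<in> par False"
  shows "br x (br y z) = br (br x y) z + br y (br x z)"
proof -
  obtain y0 y1 where y: "y0 \<in> par False" "y1 \<in> par True" "y = y0 + y1" using par_sum by blast
  obtain z0 z1 where z: "z0 \<in> par False" "z1 \<in> par True" "z = z0 + z1" using par_sum by blast
  note sj = super_jacobi[OF assms, unfolded signed_def]
  show ?thesis
    unfolding y(3) z(3)
    by (simp add: br_add_left br_add_right sj[OF y(1) z(1)] sj[OF y(1) z(2)] sj[OF y(2) z(1)]
        sj[OF y(2) z(2)] algebra_simps)
qed

text \<open>The sign depends on \<open>x\<close> and \<open>y\<close> only, so \<open>z\<close> may
  be of mixed parity.\<close>

lemma odd_jacobi: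
  assumes "x \<in> par True" "y \<in> par q"
  shows "br x (br y z) = br (br x y) z + signed q (br y (br x z))"
proof -
  obtain z0 z1 where z: "z0 \<in> par False" "z1 \<in> par True" "z = z0 + z1" using par_sum by blast
  show ?thesis
    unfolding z(3)
    by (simp add: br_add_left br_add_right super_jacobi[OF assms z(1)] super_jacobi[OF assms z(2)]
        signed_add algebra_simps)
qed

text \<open>For \<open>i \<ge> 1\<close> this is the ideal spanned by
  \<open>e\<^sub>i, \<dots>, e\<^sub>n\<close>.\<close>

definition "tail" :: "nat \<Rightarrow> 'a set" where
  "tail i = {x. \<forall>j<i. co x j = 0}"

text \<open>Homogeneity of parity \<open>p\<close> and degree \<open>-s\<close> at once; the zero
  vector has every parity and degree.\<close>

definition hom :: "bool \<Rightarrow> nat \<Rightarrow> 'a \<Rightarrow> bool" where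
  "hom p s x \<longleftrightarrow> (\<forall>j. co x j \<noteq> 0 \<longrightarrow> (j \<in> J) = p \<and> wt j = s)"

lemma hom_par: "hom p s x \<Longrightarrow> x \<in> par p"
  by (auto simp: hom_def par_iff)

lemma hom_e: "i \<in> {1..n} \<Longrightarrow> hom (i \<in> J) (wt i) (e i)"
  by (auto simp: hom_def co_e)

lemma e_tail: "i \<in> {1..n} \<Longrightarrow> k \<le> i \<Longrightarrow> e i \<in> tail k"
  by (auto simp: tail_def co_e)

lemma tail_mono: "x \<in> tail i \<Longrightarrow> k \<le> i \<Longrightarrow> x \<in> tail k"
  by (auto simp: tail_def)

lemma tail_Suc_n: "i > n \<Longrightarrow> x \<in> tail i \<Longrightarrow> x = 0"
  by (rule co_eq_0) (metis (mono_tags, lifting) atLeastAtMost_iff co_out le_less_trans mem_Collect_eq tail_def)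

lemma expand_tail:
  assumes "x \<in> tail i" "i \<ge> 1"
  shows "x = (\<Sum>j\<in>{i..n}. scale (co x j) (e j))"
proof -
  have "x = (\<Sum>j\<in>{1..n}. scale (co x j) (e j))" by (rule expand)
  also have "\<dots> = (\<Sum>j\<in>{i..n}. scale (co x j) (e j))"
    using assms by (intro sum.mono_neutral_right) (auto simp: tail_def)
  finally show ?thesis .
qed

lemma co_br_nz:
  assumes "co (br x y) l \<noteq> 0"
  obtains j k where "j \<in> {1..n}" "k \<in> {1..n}" "co x j \<noteq> 0" "co y k \<noteq> 0" "co (br (e j) (e k)) l \<noteq> 0"
proof -
  have "br x y = br (\<Sum>j\<in>{1..n}. scale (co x j) (e j)) (\<Sum>j\<in>{1..n}. scale (co y j) (e j))"
    using expand[of x] expand[of y] by simp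
  then have "(\<Sum>k\<in>{1..n}. \<Sum>j\<in>{1..n}. co y k * (co x j * co (br (e j) (e k)) l)) \<noteq> 0"
    using assms by (simp add: br_sum_left br_sum_right br_scale_left br_scale_right co_sum co_scale
        sum_distrib_left)
  then obtain j k where "j \<in> {1..n}" "k \<in> {1..n}" "co y k * (co x j * co (br (e j) (e k)) l) \<noteq> 0"
    by (meson sum.not_neutral_contains_not_neutral)
  then show ?thesis using that by auto
qed

text \<open>Every bracket moves at least one step down the chain of ideals. This makes each
  \<open>tail i\<close> an ideal and each \<open>br x\<close> nilpotent.\<close>

lemma br_tail_right:
  assumes "y \<in> tail i"
  shows "br x y \<in> tail (Suc i)"
  unfolding tail_def
proof (clarify, rule ccontr)
  fix l assume l: "l < Suc i" "co (br x y) l \<noteq> 0"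
  from l(2) obtain j k where "j \<in> {1..n}" "k \<in> {1..n}" "co x j \<noteq> 0" "co y k \<noteq> 0"
    "co (br (e j) (e k)) l \<noteq> 0" by (rule co_br_nz)
  with br_e[of j k l] have "co y k \<noteq> 0" "k < l" by auto
  with l(1) assms show False by (simp add: tail_def)
qed

lemma hom_br:
  assumes "hom p s x" "hom q t y"
  shows "hom (p \<noteq> q) (s + t) (br x y)"
proof -
  have "(l \<in> J) = (p \<noteq> q) \<and> wt l = s + t" if nz: "co (br x y) l \<noteq> 0" for l
  proof -
    have "br x y \<in> par (p \<noteq> q)" using assms hom_par br_par by blast
    moreover have "wt l = s + t"
      using nz by (rule co_br_nz) (use assms br_e in \<open>auto simp: hom_def\<close>)
    ultimately show ?thesis using nz by (auto simp: par_iff)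
  qed
  then show ?thesis by (auto simp: hom_def)
qed

text \<open>
  The terms \<open>x^a \<partial>\<^sub>j\<close> of parity \<open>p\<close> and degree \<open>-s\<close> that involve only variables with index at least \<open>i\<close>.
\<close>
definition adm :: "nat \<Rightarrow> bool \<Rightarrow> nat \<Rightarrow> nat \<Rightarrow> monom \<Rightarrow> bool" where
  "adm i p s j a \<longleftrightarrow> j \<in> {i..n} \<and> keys a \<subseteq> {i..n} \<and> (\<forall>l\<in>J. lookup a l \<le> 1) \<and> term_odd J a j = p \<and>
     (\<Sum>l\<in>keys a. int (lookup a l * wt l)) - int (wt j) = - int s"

text \<open>\<open>F\<close> is linear on the whole space, but the other clauses concern
  \<open>tail i\<close> only. Parity is listed separately from \<open>hom\<close> since an even or
  odd vector may have parts of several degrees. The last clause, on the value at 0, will give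
  injectivity.\<close>

definition realizes :: "nat \<Rightarrow> ('a \<Rightarrow> 'k vfield) \<Rightarrow> bool" where
  "realizes i F \<longleftrightarrow>
     (\<forall>x y. F (x + y) = F x + F y) \<and> (\<forall>c x. F (scale c x) = vf_scale c (F x)) \<and>
     (\<forall>x\<in>tail i. \<forall>p. x \<in> par p \<longrightarrow> F x \<in> vf_supp (\<lambda>j a. \<exists>s. adm i p s j a)) \<and>
     (\<forall>x\<in>tail i. \<forall>p s. hom p s x \<longrightarrow> F x \<in> vf_supp (adm i p s)) \<and>
     (\<forall>x\<in>tail i. \<forall>y\<in>tail i. F (br x y) = vf_bracket J (F x) (F y)) \<and>
     (CHAR('k) = 2 \<longrightarrow> (\<forall>x\<in>tail i \<inter> par True. F (sq x) = vf_square J (F x))) \<and>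
     (\<forall>x\<in>tail i. \<forall>k. lookup (lookup (F x) k) 0 = co x k)"

text \<open>The clauses that are linear or bilinear pass from basis vectors to \<open>tail i\<close>
  at once. For squares, \<open>sq_add\<close> is matched with
  \<open>(X + Y)^2 = X^2 + Y^2 + (X Y + Y X)\<close>.\<close>

lemma realizesI:
  assumes i: "i \<ge> 1"
    and add: "\<And>x y. F (x + y) = F x + F y"
    and scl: "\<And>c x. F (scale c x) = vf_scale c (F x)"
    and supp: "\<And>j. j \<in> {i..n} \<Longrightarrow> F (e j) \<in> vf_supp (adm i (j \<in> J) (wt j))"
    and brk: "\<And>j k. j \<in> {i..n} \<Longrightarrow> k \<in> {i..n} \<Longrightarrow> F (br (e j) (e k)) = vf_bracket J (F (e j)) (F (e k))"
    and sqr: "\<And>j. CHAR('k) = 2 \<Longrightarrow> j \<in> {i..n} \<Longrightarrow> j \<in> J \<Longrightarrow> F (sq (e j)) = vf_square J (F (e j))"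
    and const: "\<And>j k. j \<in> {i..n} \<Longrightarrow> lookup (lookup (F (e j)) k) 0 = (if j = k then 1 else 0)"
  shows "realizes i F"
  unfolding realizes_def
proof (intro conjI allI ballI impI)
  have F0: "F 0 = 0" using scl[of 0 0] by simp
  have Fsum: "F (sum f A) = (\<Sum>a\<in>A. F (f a))" for f and A :: "nat set"
    by (induction A rule: infinite_finite_induct) (simp_all add: F0 add)
  have Fx: "F x = (\<Sum>j\<in>{i..n}. vf_scale (co x j) (F (e j)))" if "x \<in> tail i" for x
    using arg_cong[OF expand_tail[OF that i], of F] by (simp add: Fsum scl)
  show par: "F x \<in> vf_supp (\<lambda>j a. \<exists>s. adm i p s j a)" if "x \<in> tail i" "x \<in> par p" for x p
    unfolding Fx[OF that(1)]
  proof (rule vf_supp_sum)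
    fix j assume j: "j \<in> {i..n}"
    show "vf_scale (co x j) (F (e j)) \<in> vf_supp (\<lambda>j a. \<exists>s. adm i p s j a)"
    proof (cases "co x j = 0")
      case False
      with that(2) have "(j \<in> J) = p" by (simp add: par_iff)
      with supp[OF j] show ?thesis by (intro vf_supp_scale) (auto elim: vf_supp_mono)
    qed simp
  qed
  show "F x \<in> vf_supp (adm i p s)" if "x \<in> tail i" "hom p s x" for x p s
    unfolding Fx[OF that(1)]
  proof (rule vf_supp_sum)
    fix j assume j: "j \<in> {i..n}"
    show "vf_scale (co x j) (F (e j)) \<in> vf_supp (adm i p s)"
    proof (cases "co x j = 0")
      case False
      with that(2) have "(j \<in> J) = p" "wt j = s" by (simp_all add: hom_def)
      with supp[OF j] show ?thesis by (intro vf_supp_scale) auto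
    qed simp
  qed
  show br: "F (br x y) = vf_bracket J (F x) (F y)" if "x \<in> tail i" "y \<in> tail i" for x y
  proof -
    have "br x y = br (\<Sum>j\<in>{i..n}. scale (co x j) (e j)) (\<Sum>j\<in>{i..n}. scale (co y j) (e j))"
      using expand_tail[OF that(1) i] expand_tail[OF that(2) i] by simp
    then show ?thesis
      by (simp add: Fx[OF that(1)] Fx[OF that(2)] br_sum_left br_sum_right br_scale_left
          br_scale_right Fsum scl brk vf_bracket_sum_left vf_bracket_sum_right
          vf_bracket_scale_left vf_bracket_scale_right)
  qed
  show "F (sq x) = vf_square J (F x)" if c2: "CHAR('k) = 2" and x: "x \<in> tail i \<inter> par True" for x
  proof -
    let ?S = "\<lambda>A. \<Sum>j\<in>A. scale (co x j) (e j)"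
    \<comment> \<open>The odd summands are added one at a time. Parity and membership in
      \<open>tail i\<close> are carried along for \<open>sq_add\<close> and the bracket
      clause.\<close>
    have *: "?S A \<in> par True \<and> ?S A \<in> tail i \<and> F (sq (?S A)) = vf_square J (F (?S A))" if "A \<subseteq> {i..n} \<inter> J" for A
    proof -
      have "finite A" using that finite_subset by blast
      then show ?thesis using that
      proof (induction A rule: finite_induct)
        case empty
        have "sq 0 = 0" using sq_scale[OF c2, of 0 0] subspace_0[OF par_subspace] by simp
        then show ?case
          using subspace_0[OF par_subspace] by (simp add: tail_def F0 vf_square_def)
      next
        case (insert j A)
        let ?x = "scale (co x j) (e j)" and ?y = "?S A"
        have j: "j \<in> {i..n}" "j \<in> J" "j \<in> {1..n}" using insert.prems i by auto
        have IH: "?y \<in> par True" "?y \<in> tail i" "F (sq ?y) = vf_square J (F ?y)"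
          using insert by auto
        have ej: "e j \<in> par True" using e_par[OF j(3)] j(2) by simp
        have px: "?x \<in> par True" by (rule subspace_scale[OF par_subspace ej])
        have tx: "?x \<in> tail i" using e_tail[OF j(3), of i] j(1) by (simp add: tail_def co_scale)
        have odd: "F ?x \<in> vf_supp (\<lambda>j a. term_odd J a j = True)"
          "F ?y \<in> vf_supp (\<lambda>j a. term_odd J a j = True)"
          by (rule vf_supp_mono, rule par, fact tx IH(2), fact px IH(1), auto simp: adm_def)+
        have "F (sq (?x + ?y)) = F (sq ?x) + F (sq ?y) + F (br ?x ?y)"
          by (simp add: sq_add[OF c2 px IH(1)] add)
        also have "F (sq ?x) = vf_square J (F ?x)"
          by (simp add: sq_scale[OF c2 ej] scl sqr[OF c2 j(1,2)] vf_square_def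
              vf_comp_scale_left vf_comp_scale_right power2_eq_square)
        also have "F (br ?x ?y) = vf_comp J (F ?x) (F ?y) + vf_comp J (F ?y) (F ?x)"
          by (simp only: br[OF tx IH(2)] vf_bracket_hom[OF odd] signed_def) simp
        finally have "F (sq (?x + ?y)) = vf_square J (F (?x + ?y))"
          by (simp add: IH(3) vf_square_def add vf_comp_add_left vf_comp_add_right)
        moreover have "?x + ?y \<in> par True" by (rule subspace_add[OF par_subspace px IH(1)])
        moreover have "?x + ?y \<in> tail i" using tx IH(2) by (simp add: tail_def co_add)
        ultimately show ?case using insert.hyps by simp
      qed
    qed
    have "x = ?S {i..n}" using expand_tail[OF _ i] x by blast
    also have "?S {i..n} = ?S ({i..n} \<inter> J)"
      using x by (intro sum.mono_neutral_right) (auto simp: par_iff)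
    finally show ?thesis using *[of "{i..n} \<inter> J"] by simp
  qed
  show "lookup (lookup (F x) k) 0 = co x k" if "x \<in> tail i" for x k
  proof -
    have "lookup (lookup (F x) k) 0 = (\<Sum>j\<in>{i..n}. if j = k then co x k else 0)"
      unfolding Fx[OF that] lookup_sum lookup_vf_scale by (intro sum.cong refl) (simp add: const)
    also have "\<dots> = co x k"
      using that co_out[of k x] i by (auto simp: tail_def)
    finally show ?thesis .
  qed
qed (fact add scl)+

text \<open>The start of the descending induction: \<open>tail (Suc n)\<close> is zero.\<close>

lemma realizes_Suc_n: "realizes (Suc n) (\<lambda>_. 0)"
  by (rule realizesI) auto

lemma weight_single_add:
  "(\<Sum>l\<in>keys (Poly_Mapping.single i k + a). int (lookup (Poly_Mapping.single i k + a) l * wt l)) =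
   int (k * wt i) + (\<Sum>l\<in>keys a. int (lookup a l * wt l))"
proof -
  have "(\<Sum>l\<in>keys (Poly_Mapping.single i k + a). int (lookup (Poly_Mapping.single i k + a) l * wt l)) =
    (\<Sum>l\<in>keys (Poly_Mapping.single i k). int (lookup (Poly_Mapping.single i k) l * wt l)) +
    (\<Sum>l\<in>keys a. int (lookup a l * wt l))"
    by (rule setsum_keys_plus_distrib) (simp_all add: algebra_simps)
  then show ?thesis by simp
qed

lemma realizesD:
  assumes "realizes i F"
  shows "F (x + y) = F x + F y" "F (scale c x) = vf_scale c (F x)" "F 0 = 0"
    "F (sum f A) = (\<Sum>a\<in>A. F (f a))"
    "\<lbrakk>x \<in> tail i; x \<in> par p\<rbrakk> \<Longrightarrow> F x \<in> vf_supp (\<lambda>j a. \<exists>s. adm i p s j a)"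
    "\<lbrakk>x \<in> tail i; hom p s x\<rbrakk> \<Longrightarrow> F x \<in> vf_supp (adm i p s)"
    "\<lbrakk>x \<in> tail i; y \<in> tail i\<rbrakk> \<Longrightarrow> F (br x y) = vf_bracket J (F x) (F y)"
    "\<lbrakk>CHAR('k) = 2; x \<in> tail i; x \<in> par True\<rbrakk> \<Longrightarrow> F (sq x) = vf_square J (F x)"
    "x \<in> tail i \<Longrightarrow> lookup (lookup (F x) k) 0 = co x k"
proof -
  show add: "F (x + y) = F x + F y" and scl: "F (scale c x) = vf_scale c (F x)" for x y c
    using assms by (simp_all add: realizes_def)
  show zero: "F 0 = 0" using scl[of 0 0] by simp
  show "F (sum f A) = (\<Sum>a\<in>A. F (f a))"
    by (induction A rule: infinite_finite_induct) (simp_all add: zero add)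
qed (use assms in \<open>auto simp: realizes_def\<close>)

section \<open>Adjoining an even basis vector\<close>

lemma realizes_odd_par:
  assumes "realizes i F" "x \<in> tail i" "x \<in> par p"
  shows "F x \<in> vf_supp (\<lambda>j a. term_odd J a j = p)"
  using realizesD(5)[OF assms] by (rule vf_supp_mono) (auto simp: adm_def)

lemma realizes_extend_even:
  assumes R: "realizes (Suc i) F" and i: "i \<in> {1..n}" "i \<notin> J"
  shows "\<exists>F'. realizes i F'"
proof -
  define D where "D = br (e i)"
  \<comment> \<open>The series \<open>exp(x\<^sub>i D)\<close> followed by \<open>F\<close>. On the
    ideal its terms vanish from \<open>k = n\<close> on; the cut-off \<open>2*n\<close> leaves room
    for products of two series.\<close>
  define E where "E = (\<lambda>x. \<Sum>k\<le>2*n. vf_times (dpow i k) (F ((D ^^ k) x)))"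
  \<comment> \<open>The \<open>e\<^sub>i\<close>-component is split off, so that \<open>F'\<close>
    is linear on the whole space and equals \<open>E\<close> on the ideal realized so far.\<close>
  define F' where "F' = (\<lambda>x. vf_scale (co x i) (vf_partial i) + E (x - scale (co x i) (e i)))"
  note RD = realizesD[OF R]
  have ei: "e i \<in> par False" using e_par[OF i(1)] i(2) by simp
  have D_add: "(D ^^ k) (x + y) = (D ^^ k) x + (D ^^ k) y" for k x y
    by (induction k) (simp_all add: D_def br_add_right)
  have D_scale: "(D ^^ k) (scale c x) = scale c ((D ^^ k) x)" for k x c
    by (induction k) (simp_all add: D_def br_scale_right)
  have D_0: "(D ^^ k) 0 = 0" for k
    by (induction k) (simp_all add: D_def)
  have D_sum: "D (sum f A) = (\<Sum>a\<in>A. D (f a))" for f and A :: "nat set"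
    by (simp add: D_def br_sum_right)
  have D_scale1: "D (scale c x) = scale c (D x)" for x c
    by (simp add: D_def br_scale_right)
  have E_add: "E (x + y) = E x + E y" for x y
    by (simp add: E_def D_add RD vf_times_add_right sum.distrib)
  have E_scale: "E (scale c x) = vf_scale c (E x)" for x c
    by (simp add: E_def D_scale RD vf_times_scale vf.scale_sum_right)
  have E_0: "E 0 = 0" by (simp add: E_def D_0 RD)
  have F'_add: "F' (x + y) = F' x + F' y" for x y
    by (simp add: F'_def co_add vf.scale_left_distrib scale_left_distrib E_add[symmetric] algebra_simps)
  have F'_scale: "F' (scale c x) = vf_scale c (F' x)" for x c
    by (simp add: F'_def co_scale vf.scale_right_distrib E_scale[symmetric] scale_right_diff_distrib)
  have F'_e: "F' (e i) = vf_partial i" using i(1) by (simp add: F'_def co_e E_0)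
  have F'_tail: "F' x = E x" if "x \<in> tail (Suc i)" for x
    using that by (simp add: F'_def tail_def)
  have D_tail: "(D ^^ k) x \<in> tail (Suc i + k)" if "x \<in> tail (Suc i)" for k x
    using that by (induction k) (auto simp: D_def br_tail_right)
  have D_tail': "(D ^^ k) x \<in> tail (Suc i)" if "x \<in> tail (Suc i)" for k x
    using tail_mono[OF D_tail[OF that, of k]] by simp
  \<comment> \<open>\<open>D^k x\<close> lies in \<open>tail (Suc i + k)\<close>, whose index
    exceeds \<open>n\<close> once \<open>k \<ge> n\<close>.\<close>
  have D_nil: "(D ^^ k) x = 0" if "x \<in> tail (Suc i)" "k \<ge> n" for k x
    using tail_Suc_n[OF _ D_tail[OF that(1), of k]] that(2) i(1) by simp
  have D_hom: "hom p (s + k * wt i) ((D ^^ k) x)" if "hom p s x" for p s k x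
  proof (induction k)
    case (Suc k)
    then show ?case
      using hom_br[OF hom_e[OF i(1)] Suc] i(2) by (simp add: D_def add_ac)
  qed (simp add: that)
  have D_par: "(D ^^ k) x \<in> par p" if "x \<in> par p" for p k x
    using that by (induction k) (auto simp: D_def dest: br_par[OF ei])
  \<comment> \<open>\<open>D^k\<close> increases the depth by \<open>k * wt i\<close>, and the
    factor \<open>x\<^sub>i^(k)\<close> compensates for this in the degree.\<close>
  have E_supp: "E x \<in> vf_supp (adm i p s)" if "x \<in> tail (Suc i)" "hom p s x" for x p s
    unfolding E_def
  proof (intro vf_supp_sum vf_times_supp)
    fix k
    show "F ((D ^^ k) x) \<in> vf_supp (adm (Suc i) p (s + k * wt i))"
      by (rule RD(6)[OF D_tail'[OF that(1)] D_hom[OF that(2)]])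
    fix j a assume "adm (Suc i) p (s + k * wt i) j a"
    moreover from this have "keys (Poly_Mapping.single i k + a) \<subseteq> {i..n}"
      using i keys_add[of "Poly_Mapping.single i k" a]
      by (fastforce simp: adm_def split: if_splits)
    ultimately show "adm i p s j (Poly_Mapping.single i k + a)"
      using i unfolding adm_def weight_single_add term_odd_even_var[OF i(2)]
      by (auto simp: lookup_add lookup_single when_def split: if_splits)
  qed
  have free: "F ((D ^^ k) x) \<in> vf_supp (free_of J i)" if "x \<in> tail (Suc i)" "x \<in> par p" for x k p
    using RD(5)[OF D_tail'[OF that(1)] D_par[OF that(2)]]
    by (rule vf_supp_mono) (auto simp: adm_def free_of_def in_keys_iff)
  \<comment> \<open>Differentiating the series shifts it by one step, so
    \<open>\<partial>\<^sub>i\<close> acts on \<open>E x\<close> as \<open>D\<close> acts on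
    \<open>x\<close>.\<close>
  have E_D: "vf_comp J (vf_partial i) (E x) = E (D x)" if x: "x \<in> tail (Suc i)" "x \<in> par p" for x p
  proof -
    obtain m where m: "2 * n = Suc m" using i(1) by (cases "2 * n") auto
    have "vf_comp J (vf_partial i) (E x) = vf_comp J (vf_partial i) (F x) +
      (\<Sum>k\<le>m. vf_comp J (vf_partial i) (vf_times (dpow i (Suc k)) (F ((D ^^ Suc k) x))))"
      by (simp add: E_def m vf_comp_sum_right vf_comp_add_right sum.atMost_Suc_shift
          del: sum.atMost_Suc funpow.simps)
    also have "vf_comp J (vf_partial i) (F x) = 0"
      using vf_comp_partial_free[OF free[OF x, of 0]] by simp
    also have "(\<Sum>k\<le>m. vf_comp J (vf_partial i) (vf_times (dpow i (Suc k)) (F ((D ^^ Suc k) x)))) =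
      (\<Sum>k\<le>m. vf_times (dpow i k) (F ((D ^^ Suc k) x)))"
      by (simp add: vf_comp_partial_dpow[OF i(2) free[OF x]] del: funpow.simps)
    \<comment> \<open>The added last term is zero by \<open>D_nil\<close>.\<close>
    also have "\<dots> = (\<Sum>k\<le>Suc m. vf_times (dpow i k) (F ((D ^^ Suc k) x)))"
      using D_nil[OF x(1), of "Suc (Suc m)"] m by (simp add: RD del: funpow.simps)
    finally show ?thesis by (simp add: E_def m funpow_swap1)
  qed
  have leibniz: "(D ^^ m) (br x y) = (\<Sum>k\<le>m. scale (of_nat (m choose k)) (br ((D ^^ k) x) ((D ^^ (m - k)) y)))" for m x y
  proof (induction m)
    case (Suc m)
    have "(D ^^ Suc m) (br x y) = (\<Sum>k\<le>m. scale (of_nat (m choose k))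
        (br ((D ^^ Suc k) x) ((D ^^ (m - k)) y) + br ((D ^^ k) x) ((D ^^ (Suc m - k)) y)))"
      by (simp add: Suc D_sum D_scale1) (simp add: D_def even_jacobi[OF ei] Suc_diff_le)
    then show ?case by (simp only: sum_choose_Suc[of m "\<lambda>k l. br ((D ^^ k) x) ((D ^^ l) y)"])
  qed simp
  \<comment> \<open>Grouped by the total power \<open>m\<close> of \<open>x\<^sub>i\<close>, the
    right-hand side has as its coefficient the Leibniz expansion of
    \<open>D^m [x, y]\<close>.\<close>
  have E_br: "E (br x y) = vf_bracket J (E x) (E y)"
    if x: "x \<in> tail (Suc i)" "x \<in> par p" and y: "y \<in> tail (Suc i)" "y \<in> par q" for x y p q
  proof -
    let ?g = "\<lambda>k l. vf_bracket J (vf_times (dpow i k) (F ((D ^^ k) x))) (vf_times (dpow i l) (F ((D ^^ l) y)))"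
    have g: "?g k l = vf_scale (of_nat ((k + l) choose k))
        (vf_times (dpow i (k + l)) (F (br ((D ^^ k) x) ((D ^^ l) y))))" for k l
      by (simp add: vf_bracket_dpow_dpow[OF i(2) free[OF x] free[OF y]] RD(7) D_tail' x y)
    have "vf_bracket J (E x) (E y) = (\<Sum>k\<le>2*n. \<Sum>l\<le>2*n. ?g k l)"
      by (simp only: E_def vf_bracket_sum_left) (simp only: vf_bracket_sum_right)
    also have "\<dots> = (\<Sum>m\<le>2*n. \<Sum>k\<le>m. ?g k (m - k))"
      by (rule sum_square_eq_sum_triangle) (auto simp: D_nil x y RD)
    also have "\<dots> = E (br x y)"
      unfolding E_def
    proof (rule sum.cong[OF refl])
      fix m
      show "(\<Sum>k\<le>m. ?g k (m - k)) = vf_times (dpow i m) (F ((D ^^ m) (br x y)))"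
        unfolding g leibniz by (simp add: RD vf_times_sum_right vf_times_scale)
    qed
    finally show ?thesis by simp
  qed
  have E_sq: "E (sq x) = vf_square J (E x)"
    if c2: "CHAR('k) = 2" and x: "x \<in> tail (Suc i)" "x \<in> par True" for x
  proof -
    let ?c = "\<lambda>k l. vf_comp J (F ((D ^^ k) x)) (F ((D ^^ l) x))"
    let ?g = "\<lambda>k l. vf_comp J (vf_times (dpow i k) (F ((D ^^ k) x))) (vf_times (dpow i l) (F ((D ^^ l) x)))"
    have g: "?g k l = vf_scale (of_nat ((k + l) choose k)) (vf_times (dpow i (k + l)) (?c k l))" for k l
      by (simp add: vf_comp_dpow_dpow[OF i(2) free[OF x] free[OF x]])
    have br: "F (br ((D ^^ k) x) ((D ^^ l) x)) = ?c k l + ?c l k" for k l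
      using realizes_odd_par[OF R D_tail'[OF x(1)] D_par[OF x(2)]]
      by (simp add: RD(7) D_tail' x vf_bracket_hom[where p = True and q = True] signed_def)
    \<comment> \<open>The derivation rule for squares, obtained from \<open>sq_br\<close> by letting
      \<open>x\<^sup>2\<close> act on \<open>e\<^sub>i\<close>.\<close>
    have Dsq: "D (sq x) = br (D x) x"
    proof -
      have sqx: "sq x \<in> par False" by (rule sq_even[OF c2 x(2)])
      have "D (sq x) = - br (sq x) (e i)"
        unfolding D_def using br_antisym[OF ei sqx] by (simp add: signed_def)
      also have "\<dots> = - br x (br x (e i))" by (simp only: sq_br[OF c2 x(2)])
      also have "br x (e i) = - D x"
        unfolding D_def using br_antisym[OF x(2) ei] by (simp add: signed_def)
      also have "- br x (- D x) = br x (D x)" by (simp add: br_uminus_right)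
      also have "\<dots> = br (D x) x"
        using br_antisym[OF x(2) D_par[OF x(2), of 1]] by (simp add: signed_def)
      finally show ?thesis .
    qed
    \<comment> \<open>The Leibniz rule for a square. For \<open>m > 0\<close> one \<open>D\<close>
      turns the square into the bracket \<open>[D x, x]\<close>, to which the ordinary rule applies;
      the two compositions in that bracket supply the two halves of Pascal's rule.\<close>
    have *: "F ((D ^^ m) (sq x)) = (\<Sum>k\<le>m. vf_scale (of_nat (m choose k)) (?c k (m - k)))" for m
    proof (cases m)
      case 0
      then show ?thesis by (simp add: RD(8) c2 x vf_square_def)
    next
      case (Suc r)
      have "F ((D ^^ m) (sq x)) = F ((D ^^ r) (br (D x) x))"
        by (simp add: Suc funpow_swap1 Dsq[symmetric])
      also have "\<dots> = (\<Sum>k\<le>r. vf_scale (of_nat (r choose k)) (F (br ((D ^^ Suc k) x) ((D ^^ (r - k)) x))))"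
        by (simp add: leibniz RD funpow_swap1)
      also have "\<dots> = (\<Sum>k\<le>r. vf_scale (of_nat (r choose k)) (?c (Suc k) (r - k))) +
          (\<Sum>k\<le>r. vf_scale (of_nat (r choose k)) (?c (r - k) (Suc k)))"
        by (simp only: br vf.scale_right_distrib sum.distrib)
      also have "(\<Sum>k\<le>r. vf_scale (of_nat (r choose k)) (?c (r - k) (Suc k))) =
          (\<Sum>k\<le>r. vf_scale (of_nat (r choose k)) (?c k (Suc r - k)))"
        by (rule sum.reindex_bij_witness[where i = "\<lambda>k. r - k" and j = "\<lambda>k. r - k"])
          (auto simp: binomial_symmetric[symmetric] Suc_diff_le)
      finally show ?thesis
        by (simp only: Suc vf.sum_choose_Suc[of r ?c] vf.scale_right_distrib sum.distrib)
    qed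
    have "vf_square J (E x) = (\<Sum>k\<le>2*n. \<Sum>l\<le>2*n. ?g k l)"
      unfolding vf_square_def by (simp only: E_def vf_comp_sum_left) (simp only: vf_comp_sum_right)
    also have "\<dots> = (\<Sum>m\<le>2*n. \<Sum>k\<le>m. ?g k (m - k))"
      by (rule sum_square_eq_sum_triangle) (auto simp: D_nil x RD)
    also have "\<dots> = E (sq x)"
      unfolding E_def
    proof (rule sum.cong[OF refl])
      fix m
      show "(\<Sum>k\<le>m. ?g k (m - k)) = vf_times (dpow i m) (F ((D ^^ m) (sq x)))"
        unfolding g * by (simp add: vf_times_sum_right vf_times_scale)
    qed
    finally show ?thesis by simp
  qed
  have tl: "e j \<in> tail (Suc i)" "j \<in> {1..n}" if "j \<in> {i..n}" "j \<noteq> i" for j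
    using that i(1) by (auto intro!: e_tail)
  have pd: "(vf_partial i :: 'k vfield) \<in> vf_supp (adm i False (wt i))"
    using i by (auto simp: vf_partial_def vf_supp_vmon adm_def term_odd_def simp del: single_one)
  have pd_odd: "(vf_partial i :: 'k vfield) \<in> vf_supp (\<lambda>j a. term_odd J a j = False)"
    using pd by (rule vf_supp_mono) (auto simp: adm_def)
  have E_odd: "E (e j) \<in> vf_supp (\<lambda>l a. term_odd J a l = (j \<in> J))" if "j \<in> {i..n}" "j \<noteq> i" for j
    using E_supp[OF tl(1)[OF that] hom_e[OF tl(2)[OF that]]] by (rule vf_supp_mono) (auto simp: adm_def)
  \<comment> \<open>Composition into \<open>\<partial>\<^sub>i\<close> is zero, so the bracket with
    \<open>\<partial>\<^sub>i\<close> is the composition in \<open>E_D\<close>.\<close>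
  have E_D': "vf_bracket J (vf_partial i) (E (e j)) = E (D (e j))" if "j \<in> {i..n}" "j \<noteq> i" for j
    by (simp add: vf_bracket_hom[OF pd_odd E_odd[OF that]] vf_comp_to_partial
        E_D[OF tl(1)[OF that] e_par[OF tl(2)[OF that]]])
  have D_e_tail: "D (e j) \<in> tail (Suc i)" if "j \<in> {i..n}" "j \<noteq> i" for j
    using D_tail'[OF tl(1)[OF that], of 1] by simp
  have "realizes i F'"
  proof (rule realizesI[OF _ F'_add F'_scale])
    show "1 \<le> i" using i by simp
    show "F' (e j) \<in> vf_supp (adm i (j \<in> J) (wt j))" if j: "j \<in> {i..n}" for j
      using pd i(2) E_supp[OF tl(1)[OF j] hom_e[OF tl(2)[OF j]]] F'_tail[OF tl(1)[OF j]]
      by (cases "j = i") (auto simp: F'_e)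
    show "F' (br (e j) (e k)) = vf_bracket J (F' (e j)) (F' (e k))"
      if j: "j \<in> {i..n}" and k: "k \<in> {i..n}" for j k
    proof (cases "j = i"; cases "k = i")
      assume "j = i" "k = i"
      moreover have "br (e i) (e i) = 0" by (rule br_even_self[OF ei])
      ultimately show ?thesis
        by (simp add: F'_e vf_bracket_hom[OF pd_odd pd_odd] vf_comp_to_partial)
          (simp add: F'_def E_0)
    next
      assume jk: "j = i" "k \<noteq> i"
      then show ?thesis
        using F'_tail[OF D_e_tail[OF k]]
        by (simp add: F'_e F'_tail[OF tl(1)[OF k]] E_D'[OF k]) (simp add: D_def)
    next
      assume jk: "j \<noteq> i" "k = i"
      have "br (e j) (e i) = scale (- 1) (D (e j))"
        using br_antisym[OF e_par[OF tl(2)[OF j jk(1)]] ei] by (simp add: D_def signed_def)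
      then show ?thesis
        using jk F'_tail[OF D_e_tail[OF j]]
        by (simp add: F'_scale F'_e F'_tail[OF tl(1)[OF j]] E_D'[OF j] vf_bracket_antisym_even[OF pd_odd] del: scale_minus_left)
    next
      assume jk: "j \<noteq> i" "k \<noteq> i"
      note tj = tl[OF j jk(1)] and tk = tl[OF k jk(2)]
      have "br (e j) (e k) \<in> tail (Suc i)" using tail_mono[OF br_tail_right[OF tk(1)]] by simp
      then show ?thesis
        by (simp add: F'_tail tj tk E_br[OF tj(1) e_par[OF tj(2)] tk(1) e_par[OF tk(2)]])
    qed
    show "F' (sq (e j)) = vf_square J (F' (e j))" if c2: "CHAR('k) = 2" and j: "j \<in> {i..n}" "j \<in> J" for j
    proof -
      have ji: "j \<noteq> i" using j(2) i(2) by blast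
      have "sq (e j) \<in> tail (Suc i)"
        using sq_e[OF c2 j(2)] j(1) unfolding tail_def by (auto simp: less_Suc_eq_le) (metis leD le_trans)
      then show ?thesis
        using E_sq[OF c2 tl(1)[OF j(1) ji]] e_par[OF tl(2)[OF j(1) ji]] j(2)
        by (simp add: F'_tail tl(1)[OF j(1) ji])
    qed
    show "lookup (lookup (F' (e j)) k) 0 = (if j = k then 1 else 0)" if j: "j \<in> {i..n}" for j k
    proof (cases "j = i")
      case True
      then show ?thesis by (simp add: F'_e vf_partial_def lookup_single when_def del: single_one)
    next
      case False
      note tj = tl[OF j False]
      \<comment> \<open>At 0 only the term of the series with index 0 is left.\<close>
      have "lookup (lookup (E x) k) 0 = (\<Sum>l\<le>2*n. if l = 0 then lookup (lookup (F x) k) 0 else 0)" for x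
        unfolding E_def lookup_sum by (intro sum.cong refl) (simp add: lookup_vf_times_0)
      then show ?thesis by (simp add: F'_tail tj RD(9) co_e[OF tj(2)])
    qed
  qed
  then show ?thesis by blast
qed

section \<open>Squares of odd vectors, and adjoining an odd basis vector\<close>

lemma numeral_neq_0:
  assumes "CHAR('k) \<noteq> m" "m = 2 \<or> m = 3"
  shows "of_nat m \<noteq> (0 :: 'k)"
proof
  assume "of_nat m = (0 :: 'k)"
  then have d: "CHAR('k) dvd m" by (simp add: of_nat_eq_0_iff_char_dvd)
  moreover have "CHAR('k) \<noteq> 1" by simp
  moreover have "CHAR('k) \<le> m" "CHAR('k) > 0" using dvd_imp_le[OF d] dvd_pos_nat[OF _ d] assms(2) by auto
  ultimately have "CHAR('k) = 2" "m = 3" using assms by linarith+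
  with d show False by simp
qed

lemma char_two: "CHAR('k) = 2 \<Longrightarrow> (2 :: 'k) = 0"
  using of_nat_eq_0_iff_char_dvd[of 2, where 'a = 'k] by simp

text \<open>A square of \<open>x\<close> in every characteristic. That \<open>[x, q] = 0\<close> has
  three sources: in characteristic 2 it follows from \<open>[x, x] = 2 q = 0\<close>, in
  characteristic 3 it is the axiom \<open>char3_odd\<close>, and otherwise the Jacobi identity gives
  \<open>3 [x, [x, x]] = 0\<close>.\<close>

lemma odd_half_square:
  assumes "x \<in> par True"
  defines "q \<equiv> (if CHAR('k) = 2 then sq x else scale (1 / 2) (br x x))"
  shows "br x x = scale 2 q" "br q y = br x (br x y)" "br x q = 0" "q \<in> par False"
proof -
  note x = assms(1)
  have xx: "br x x \<in> par False" using br_par[OF x x] by simp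
  show q: "q \<in> par False"
    using sq_even[OF _ x] subspace_scale[OF par_subspace xx] by (simp add: q_def)
  have xx2: "br x x = scale 2 q \<and> (\<forall>y. br q y = br x (br x y))"
  proof (cases "CHAR('k) = 2")
    case True
    have dbl: "z + z = 0" for z :: 'a using scale_left_distrib[of 1 1 z] char_two[OF True] by simp
    \<comment> \<open>Expanding \<open>sq (x + x)\<close>, which is \<open>sq 0\<close>, leaves only
      \<open>[x, x]\<close>.\<close>
    have "sq 0 = 0" using sq_scale[OF True x, of 0] by simp
    then have "br x x = 0" using sq_add[OF True x x] dbl by simp
    then show ?thesis using True dbl sq_br[OF True x] char_two[OF True] by (simp add: q_def)
  next
    case False
    have "br (br x x) y = scale 2 (br x (br x y))" for y
      using odd_jacobi[OF x x, of y] scale_left_distrib[of 1 1 "br x (br x y)"]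
      by (simp add: signed_def algebra_simps)
    then show ?thesis
      using False numeral_neq_0[OF False] by (simp add: q_def br_scale_left)
  qed
  then show "br x x = scale 2 q" "br q y = br x (br x y)" by auto
  show "br x q = 0"
  proof (cases "CHAR('k) = 2")
    case True
    have "br x q = - br q x" using br_antisym[OF x q] by (simp add: signed_def)
    also have "br q x = br x (br x x)" using xx2 by simp
    also have "br x x = 0" using xx2 char_two[OF True] by simp
    finally show ?thesis by simp
  next
    case False
    have "br x (br x x) = 0"
    proof (cases "CHAR('k) = 3")
      case True
      then show ?thesis by (rule char3_odd[OF _ x])
    next
      case F3: False
      \<comment> \<open>Antisymmetry gives \<open>w = - v\<close> and the Jacobi identity
        \<open>w = v - w\<close>; eliminating \<open>v\<close> yields
        \<open>3 w = 0\<close>.\<close>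
      define w v where "w = br x (br x x)" and "v = br (br x x) x"
      have "w = - v" unfolding w_def v_def using br_antisym[OF x xx] by (simp add: signed_def)
      moreover have "w = v - w"
        unfolding w_def v_def using odd_jacobi[OF x x, of x] by (simp add: signed_def)
      ultimately have "w + w + w = w + w + (- w - w)" by simp
      then have "br x (br x x) + br x (br x x) + br x (br x x) = 0" by (simp add: w_def)
      then have "scale 3 (br x (br x x)) = 0"
        using scale_left_distrib[of 1 2 "br x (br x x)"] scale_left_distrib[of 1 1 "br x (br x x)"] by (simp add: add.assoc)
      moreover have "(3 :: 'k) \<noteq> 0"
        using numeral_neq_0[OF F3] by simp
      ultimately show ?thesis by simp
    qed
    then show ?thesis using False by (simp add: q_def br_scale_right)
  qed
qed

lemma realizes_extend_odd:
  assumes R: "realizes (Suc i) F" and i: "i \<in> J"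
  shows "\<exists>F'. realizes i F'"
proof -
  have i1: "i \<in> {1..n}" using i J by blast
  define D where "D = br (e i)"
  define q where "q = (if CHAR('k) = 2 then sq (e i) else scale (1 / 2) (br (e i) (e i)))"
  \<comment> \<open>Multiplication by \<open>x\<^sub>i\<close>, since the factor \<open>1/1!\<close>
    in \<open>dpow\<close> is 1.\<close>
  define xi where "xi = vf_times (dpow i (Suc 0) :: 'k func)"
  define Z where "Z = vf_partial i + xi (F q)"
  define E where "E = (\<lambda>x. F x + xi (F (D x)))"
  define F' where "F' = (\<lambda>x. vf_scale (co x i) Z + E (x - scale (co x i) (e i)))"
  note RD = realizesD[OF R]
  have ei: "e i \<in> par True" using e_par[OF i1] i by simp
  have q: "br (e i) (e i) = scale 2 q" "br q y = D (D y)" "D q = 0" "q \<in> par False" for y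
    unfolding q_def D_def by (fact odd_half_square[OF ei])+
  have xi: "xi (X + Y) = xi X + xi Y" "xi (X - Y) = xi X - xi Y" "xi (vf_scale c X) = vf_scale c (xi X)"
     "xi (- X) = - xi X" "xi 0 = 0" for X Y c
    by (simp_all add: xi_def vf_times_add_right vf_times_diff_right vf_times_scale vf_times_uminus_right)
  have D_add: "D (x + y) = D x + D y" and D_scale: "D (scale c x) = scale c (D x)" for x y c
    by (simp_all add: D_def br_add_right br_scale_right)
  have E_add: "E (x + y) = E x + E y" for x y
    by (simp add: E_def D_add RD xi)
  have E_scale: "E (scale c x) = vf_scale c (E x)" for x c
    by (simp add: E_def D_scale RD xi vf.scale_right_distrib)
  have E_0: "E 0 = 0" using E_scale[of 0 0] by simp
  have F'_add: "F' (x + y) = F' x + F' y" for x y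
    by (simp add: F'_def co_add vf.scale_left_distrib scale_left_distrib E_add[symmetric] algebra_simps)
  have F'_scale: "F' (scale c x) = vf_scale c (F' x)" for x c
    by (simp add: F'_def co_scale vf.scale_right_distrib E_scale[symmetric] scale_right_diff_distrib)
  have F'_e: "F' (e i) = Z" using i1 by (simp add: F'_def co_e E_0)
  have F'_tail: "F' x = E x" if "x \<in> tail (Suc i)" for x
    using that by (simp add: F'_def tail_def)
  have D_tail: "D x \<in> tail (Suc i)" if "x \<in> tail (Suc i)" for x
    using tail_mono[OF br_tail_right[OF that]] by (simp add: D_def)
  have D_par: "D x \<in> par (\<not> p)" if "x \<in> par p" for p x
    using br_par[OF ei that] by (simp add: D_def)
  have D_hom: "hom (\<not> p) (wt i + s) (D x)" if "hom p s x" for p s x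
    using hom_br[OF hom_e[OF i1] that] i by (simp add: D_def)
  have q_tail: "q \<in> tail (Suc i)"
  proof (cases "CHAR('k) = 2")
    case True
    then show ?thesis using sq_e[OF True i] by (force simp: q_def tail_def)
  next
    case False
    then show ?thesis
      using br_tail_right[OF e_tail[OF i1 order_refl], of "e i"] by (simp add: q_def tail_def co_scale)
  qed
  have q_hom: "hom False (wt i + wt i) q"
  proof (cases "CHAR('k) = 2")
    case True
    then show ?thesis using sq_e[OF True i] q(4) by (fastforce simp: q_def hom_def par_iff)
  next
    case False
    then show ?thesis
      using hom_br[OF hom_e[OF i1] hom_e[OF i1]] by (simp add: q_def hom_def co_scale)
  qed
  \<comment> \<open>\<open>x\<^sub>i\<close> reverses the parity and raises the degree by
    \<open>wt i\<close>, which undoes the effect of \<open>D\<close>.\<close>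
  have adm_xi: "adm i p s j (Poly_Mapping.single i (Suc 0) + a)" if "adm (Suc i) (\<not> p) (wt i + s) j a" for p s j a
  proof -
    have "i \<notin> keys a" using that by (auto simp: adm_def)
    then have ai: "lookup a i = 0" by (simp add: in_keys_iff)
    have "keys (Poly_Mapping.single i (Suc 0) + a) \<subseteq> {i..n}"
      using that i1 unfolding keys_single_add by (fastforce simp: adm_def)
    then show ?thesis
      using that i unfolding adm_def weight_single_add term_odd_odd_var[OF i ai]
      by (auto simp: lookup_add lookup_single when_def ai)
  qed
  have xi_supp: "xi (F x) \<in> vf_supp (adm i p s)" if "x \<in> tail (Suc i)" "hom (\<not> p) (wt i + s) x" for x p s
    unfolding xi_def by (rule vf_times_supp[OF RD(6)[OF that]]) (rule adm_xi)
  have E_supp: "E x \<in> vf_supp (adm i p s)" if x: "x \<in> tail (Suc i)" "hom p s x" for x p s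
  proof -
    have "F x \<in> vf_supp (adm i p s)"
      using RD(6)[OF x] by (rule vf_supp_mono) (auto simp: adm_def)
    then show ?thesis
      unfolding E_def using xi_supp[OF D_tail[OF x(1)] D_hom[OF x(2)]] by (rule vf_supp_add)
  qed
  have Z_supp: "Z \<in> vf_supp (adm i True (wt i))"
    unfolding Z_def
  proof (rule vf_supp_add)
    show "vf_partial i \<in> vf_supp (adm i True (wt i))"
      using i i1 by (auto simp: vf_partial_def vf_supp_vmon adm_def term_odd_def simp del: single_one)
    show "xi (F q) \<in> vf_supp (adm i True (wt i))"
      by (rule xi_supp[OF q_tail]) (use q_hom in simp)
  qed
  have Z_odd: "Z \<in> vf_supp (\<lambda>j a. term_odd J a j = True)"
    using Z_supp by (rule vf_supp_mono) (auto simp: adm_def)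
  have free': "F x \<in> vf_supp (\<lambda>j a. free_below J i j a \<and> term_odd J a j = p)"
    if "x \<in> tail (Suc i)" "x \<in> par p" for x p
    using RD(5)[OF that] by (rule vf_supp_mono) (auto simp: adm_def free_below_def)
  have free: "F x \<in> vf_supp (free_below J i)" if "x \<in> tail (Suc i)" "x \<in> par p" for x p
    using free'[OF that] by (rule vf_supp_mono) auto
  have free_of: "F x \<in> vf_supp (free_of J i)" if "x \<in> tail (Suc i)" "x \<in> par p" for x p
    using free[OF that] by (rule vf_supp_mono) (rule free_below_imp_free_of)
  note cx = vf_comp_xi_left[OF i free free, folded xi_def] vf_comp_xi_right[OF i free' free, folded xi_def]
    vf_comp_xi_xi[OF i free free, folded xi_def] vf_comp_partial_xi[OF i free, folded xi_def]
    vf_comp_partial_free[OF free_of] vf_comp_to_partial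
  \<comment> \<open>The product of the two \<open>x\<^sub>i\<close>-terms vanishes, and the sign
    comes from moving \<open>x\<^sub>i\<close> past \<open>F x\<close>.\<close>
  have EE: "vf_comp J (E x) (E y) = vf_comp J (F x) (F y) + signed p (xi (vf_comp J (F x) (F (D y)))) +
      xi (vf_comp J (F (D x)) (F y))"
    if x: "x \<in> tail (Suc i)" "x \<in> par p" and y: "y \<in> tail (Suc i)" "y \<in> par r" for x y p r
    using cx(1)[OF D_tail[OF x(1)] D_par[OF x(2)] y] cx(2)[OF x D_tail[OF y(1)] D_par[OF y(2)]]
      cx(3)[OF D_tail[OF x(1)] D_par[OF x(2)] D_tail[OF y(1)] D_par[OF y(2)]]
    by (simp add: E_def vf_comp_add_left vf_comp_add_right)
  \<comment> \<open>\<open>\<partial>\<^sub>i\<close> kills \<open>F x\<close> and turns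
    \<open>x\<^sub>i F(D x)\<close> into \<open>F(D x)\<close>; the part
    \<open>x\<^sub>i F(q)\<close> contributes through \<open>F x\<close> only.\<close>
  have ZE: "vf_comp J Z (E x) = F (D x) + xi (vf_comp J (F q) (F x))"
    if x: "x \<in> tail (Suc i)" "x \<in> par p" for x p
    using cx(1)[OF q_tail q(4) x] cx(3)[OF q_tail q(4) D_tail[OF x(1)] D_par[OF x(2)]]
      cx(4)[OF D_tail[OF x(1)] D_par[OF x(2)]] cx(5)[OF x]
    by (simp add: E_def Z_def vf_comp_add_left vf_comp_add_right)
  have EZ: "vf_comp J (E x) Z = signed p (xi (vf_comp J (F x) (F q)))"
    if x: "x \<in> tail (Suc i)" "x \<in> par p" for x p
    using cx(2)[OF x q_tail q(4)] cx(3)[OF D_tail[OF x(1)] D_par[OF x(2)] q_tail q(4)]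
    by (simp add: E_def Z_def vf_comp_add_left vf_comp_add_right vf_comp_to_partial)
  \<comment> \<open>Only \<open>\<partial>\<^sub>i\<close> applied to \<open>x\<^sub>i F(q)\<close>
    is left.\<close>
  have ZZ: "vf_comp J Z Z = F q"
    using cx(4)[OF q_tail q(4)] cx(3)[OF q_tail q(4) q_tail q(4)]
    by (simp add: Z_def vf_comp_add_left vf_comp_add_right vf_comp_to_partial)
  have Fbr: "F (br x y) = vf_comp J (F x) (F y) - signed (p \<and> r) (vf_comp J (F y) (F x))"
    if x: "x \<in> tail (Suc i)" "x \<in> par p" and y: "y \<in> tail (Suc i)" "y \<in> par r" for x y p r
    by (simp only: RD(7)[OF x(1) y(1)] vf_bracket_hom[OF realizes_odd_par[OF R x] realizes_odd_par[OF R y]])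
  \<comment> \<open>\<open>D q = 0\<close> removes the \<open>x\<^sub>i\<close>-term, so the square
    of \<open>Z\<close> is the image of \<open>q\<close>.\<close>
  have E_q: "E q = F q" by (simp add: E_def q(3) RD xi)
  have tl: "e j \<in> tail (Suc i)" "j \<in> {1..n}" if "j \<in> {i..n}" "j \<noteq> i" for j
    using that i1 by (auto intro!: e_tail)
  have E_odd: "E (e j) \<in> vf_supp (\<lambda>l a. term_odd J a l = (j \<in> J))" if "j \<in> {i..n}" "j \<noteq> i" for j
    using E_supp[OF tl(1)[OF that] hom_e[OF tl(2)[OF that]]] by (rule vf_supp_mono) (auto simp: adm_def)
  \<comment> \<open>The terms with \<open>x\<^sub>i\<close> combine to
    \<open>x\<^sub>i F([q, e\<^sub>j])\<close>, and
    \<open>[q, e\<^sub>j] = D (D e\<^sub>j)\<close>.\<close>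
  have ZE_br: "vf_bracket J Z (E (e j)) = E (D (e j))" if j: "j \<in> {i..n}" "j \<noteq> i" for j
  proof -
    note x = tl(1)[OF j] e_par[OF tl(2)[OF j]]
    have "E (D (e j)) = F (D (e j)) + xi (F (br q (e j)))"
      by (simp add: E_def q(2))
    then show ?thesis
      by (simp add: vf_bracket_hom[OF Z_odd E_odd[OF j]] ZE[OF x] EZ[OF x] Fbr[OF q_tail q(4) x] xi)
        (simp add: signed_def)
  qed
  have "realizes i F'"
  proof (rule realizesI[OF _ F'_add F'_scale])
    show "1 \<le> i" using i1 by simp
    show "F' (e j) \<in> vf_supp (adm i (j \<in> J) (wt j))" if j: "j \<in> {i..n}" for j
      using Z_supp i E_supp[OF tl(1)[OF j] hom_e[OF tl(2)[OF j]]] F'_tail[OF tl(1)[OF j]]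
      by (cases "j = i") (auto simp: F'_e)
    show "F' (br (e j) (e k)) = vf_bracket J (F' (e j)) (F' (e k))"
      if j: "j \<in> {i..n}" and k: "k \<in> {i..n}" for j k
    proof (cases "j = i"; cases "k = i")
      assume "j = i" "k = i"
      then show ?thesis
        using vf.scale_left_distrib[of 1 1 "F q"]
        by (simp add: F'_e vf_bracket_hom[OF Z_odd Z_odd] ZZ q(1) F'_scale F'_tail[OF q_tail] E_q signed_def)
    next
      assume jk: "j = i" "k \<noteq> i"
      then show ?thesis
        using F'_tail[OF D_tail[OF tl(1)[OF k]]]
        by (simp add: F'_e F'_tail[OF tl(1)[OF k]] ZE_br[OF k]) (simp add: D_def)
    next
      assume jk: "j \<noteq> i" "k = i"
      have "br (e j) (e i) = scale (if j \<in> J then 1 else - 1) (D (e j))"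
        using br_antisym[OF e_par[OF tl(2)[OF j jk(1)]] ei] by (simp add: D_def signed_def)
      moreover have "vf_bracket J (E (e j)) Z = vf_scale (if j \<in> J then 1 else - 1) (vf_bracket J Z (E (e j)))"
        by (simp add: vf_bracket_hom[OF Z_odd E_odd[OF j jk(1)]] vf_bracket_hom[OF E_odd[OF j jk(1)] Z_odd] signed_def)
      ultimately show ?thesis
        using jk F'_tail[OF D_tail[OF tl(1)[OF j jk(1)]]]
        by (simp only: F'_scale F'_e F'_tail[OF tl(1)[OF j jk(1)]] ZE_br[OF j jk(1)])
    next
      assume jk: "j \<noteq> i" "k \<noteq> i"
      note tj = tl[OF j jk(1)] and tk = tl[OF k jk(2)]
      note x = tj(1) e_par[OF tj(2)] and y = tk(1) e_par[OF tk(2)]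
      have "br (e j) (e k) \<in> tail (Suc i)" using tail_mono[OF br_tail_right[OF tk(1)]] by simp
      then have "F' (br (e j) (e k)) = F (br (e j) (e k)) + xi (F (D (br (e j) (e k))))"
        by (simp add: F'_tail E_def)
      \<comment> \<open>The terms without \<open>x\<^sub>i\<close> agree because \<open>F\<close>
        respects the bracket, those with \<open>x\<^sub>i\<close> because \<open>D\<close> is an odd
        derivation.\<close>
      also have "D (br (e j) (e k)) = br (D (e j)) (e k) + scale (if j \<in> J then - 1 else 1) (br (e j) (D (e k)))"
        unfolding D_def by (simp add: odd_jacobi[OF ei x(2)] signed_def)
      finally show ?thesis
        unfolding F'_tail[OF tj(1)] F'_tail[OF tk(1)] vf_bracket_hom[OF E_odd[OF j jk(1)] E_odd[OF k jk(2)]]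
        by (simp add: RD Fbr[OF x y] Fbr[OF D_tail[OF x(1)] D_par[OF x(2)] y] Fbr[OF x D_tail[OF y(1)] D_par[OF y(2)]]
            EE[OF x y] EE[OF y x] xi signed_def)
    qed
    show "F' (sq (e j)) = vf_square J (F' (e j))" if c2: "CHAR('k) = 2" and j: "j \<in> {i..n}" "j \<in> J" for j
    proof (cases "j = i")
      case True
      have "F' q = vf_square J (F' (e i))"
        by (simp add: F'_tail[OF q_tail] E_q F'_e vf_square_def ZZ)
      then show ?thesis using True c2 by (simp add: q_def)
    next
      case False
      note t = tl[OF j(1) False]
      have x: "e j \<in> tail (Suc i)" "e j \<in> par True" using t e_par[OF t(2)] j(2) by auto
      have sqt: "sq (e j) \<in> tail (Suc i)"
        using sq_e[OF c2 j(2)] j(1) unfolding tail_def by (auto simp: less_Suc_eq_le) (metis leD le_trans)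
      \<comment> \<open>The coefficient of \<open>x\<^sub>i\<close> in the square of
        \<open>E e\<^sub>j\<close> is \<open>F([D e\<^sub>j, e\<^sub>j])\<close>, so the derivation
        rule for squares is what has to be shown.\<close>
      have "D (sq (e j)) = - br (sq (e j)) (e i)"
        unfolding D_def using br_antisym[OF ei sq_even[OF c2 x(2)]] by (simp add: signed_def)
      also have "br (sq (e j)) (e i) = br (e j) (br (e j) (e i))" by (rule sq_br[OF c2 x(2)])
      also have "br (e j) (e i) = D (e j)"
        unfolding D_def using br_antisym[OF x(2) ei] by (simp add: signed_def)
      also have "- br (e j) (D (e j)) = br (D (e j)) (e j)"
        using br_antisym[OF x(2) D_par[OF x(2)]] by (simp add: signed_def)
      finally have Dsq: "D (sq (e j)) = br (D (e j)) (e j)" .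
      show ?thesis
        unfolding F'_tail[OF sqt] F'_tail[OF x(1)] vf_square_def EE[OF x x]
        by (simp add: E_def Dsq Fbr[OF D_tail[OF x(1)] D_par[OF x(2)] x] RD(8)[OF c2 x] vf_square_def xi signed_def)
    qed
    show "lookup (lookup (F' (e j)) k) 0 = (if j = k then 1 else 0)" if j: "j \<in> {i..n}" for j k
    proof -
      have xi0: "lookup (lookup (xi X) k) 0 = 0" for X unfolding xi_def by (rule lookup_vf_times_0) simp
      show ?thesis
      proof (cases "j = i")
        case True
        have "lookup (lookup (F' (e i)) k) 0 = lookup (lookup (vf_partial i :: 'k vfield) k) 0"
          by (simp add: F'_e Z_def lookup_add xi0)
        then show ?thesis
          using True by (simp add: vf_partial_def lookup_single when_def del: single_one)
      next
        case False
        note tj = tl[OF j False]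
        then show ?thesis by (simp add: F'_tail tj RD(9) co_e[OF tj(2)] E_def lookup_add xi0)
      qed
    qed
  qed
  then show ?thesis by blast
qed

section \<open>The descending induction and the resulting embedding\<close>

lemma exists_realization: "\<exists>F. realizes 1 F"
proof -
  have "\<exists>F. realizes i F" if "1 \<le> i" "i \<le> Suc n" for i
    using that(2,1)
  proof (induction rule: inc_induct)
    case base
    then show ?case using realizes_Suc_n by blast
  next
    case (step i)
    then show ?case using realizes_extend_even[of i] realizes_extend_odd[of i] by (cases "i \<in> J") auto
  qed
  then show ?thesis by simp
qed

lemma tail_1: "tail 1 = UNIV"
  by (auto simp: tail_def co_out)

lemma realizes_embedding:
  assumes R: "realizes 1 F"
  shows "embedding_into_vect n J F"
    "i \<in> {1..n} \<Longrightarrow> F (e i) \<in> vect_deg n J wt (- int (wt i))"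
    "lookup (lookup (F x) k) 0 = co x k"
proof -
  note RD = realizesD[OF R, unfolded tail_1, simplified UNIV_I True_implies_equals]
  show value0: "lookup (lookup (F x) k) 0 = co x k" for x k by (rule RD)
  have Fvect: "F x \<in> vect n J" for x
  proof -
    obtain x0 x1 where x: "x0 \<in> par False" "x1 \<in> par True" "x = x0 + x1" using par_sum by blast
    have "F x0 \<in> vf_supp (\<lambda>j a. \<exists>p s. adm 1 p s j a)" "F x1 \<in> vf_supp (\<lambda>j a. \<exists>p s. adm 1 p s j a)"
      by (rule vf_supp_mono[OF RD(5)[OF x(1)]] vf_supp_mono[OF RD(5)[OF x(2)]], blast)+
    then have *: "F x \<in> vf_supp (\<lambda>j a. \<exists>p s. adm 1 p s j a)" by (simp add: x(3) RD vf_supp_add)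
    have "F x \<in> vf_supp (\<lambda>j a. j \<in> {1..n} \<and> keys a \<subseteq> {1..n} \<and> (\<forall>i\<in>J. lookup a i \<le> 1))"
      using * by (rule vf_supp_mono) (auto simp: adm_def)
    \<comment> \<open>A nonzero component has a term, so the condition on terms also bounds the set
      of components.\<close>
    moreover have "\<exists>a. a \<in> keys (lookup (F x) j)" if "j \<in> keys (F x)" for j
      using that by (metis in_keys_iff keys_eq_empty ex_in_conv)
    ultimately show ?thesis by (force simp: vect_def vf_supp_def func_space_def)
  qed
  have Fpar: "F x \<in> vect_par n J p" if "x \<in> par p" for x p
  proof -
    have "F x \<in> vf_supp (\<lambda>j a. term_odd J a j = p)"
      using RD(5)[OF that] by (rule vf_supp_mono) (auto simp: adm_def)
    with Fvect[of x] show ?thesis by (auto simp: vect_par_def vf_supp_def)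
  qed
  show "F (e i) \<in> vect_deg n J wt (- int (wt i))" if "i \<in> {1..n}" for i
  proof -
    have "F (e i) \<in> vf_supp (\<lambda>j a. (\<Sum>l\<in>keys a. int (lookup a l * wt l)) - int (wt j) = - int (wt i))"
      using RD(6)[OF hom_e[OF that]] by (rule vf_supp_mono) (auto simp: adm_def)
    with Fvect[of "e i"] show ?thesis by (auto simp: vect_deg_def vf_supp_def)
  qed
  have "Vector_Spaces.linear scale vf_scale F"
    by (simp add: Vector_Spaces.linear_iff vector_space_axioms vf.vector_space_axioms RD)
  \<comment> \<open>All coordinates can be read off from the value at 0.\<close>
  moreover have "inj F"
  proof (rule injI)
    fix x y assume "F x = F y"
    then have "co x j = co y j" for j using value0 by metis
    then show "x = y" using expand[of x] expand[of y] by simp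
  qed
  ultimately show "embedding_into_vect n J F"
    unfolding embedding_into_vect_def using Fvect Fpar RD(7,8) by auto
qed

end

section \<open>Values at the origin\<close>

lemma lookup_value_at_0:
  "lookup (lookup (value_at_0 X) j) a = (if a = 0 then lookup (lookup X j) 0 else 0)"
  by (auto simp: value_at_0_def Poly_Mapping.map.rep_eq when_def lookup_single)

lemma lookup_vf_partial: "lookup (lookup (vf_partial i) j) a = (if j = i \<and> a = 0 then 1 else 0)"
  by (auto simp: vf_partial_def lookup_single when_def simp del: single_one)

lemma independent_vf_partial: "vf.independent (vf_partial ` {1..n} :: 'k::field vfield set)"
  and card_vf_partial: "card (vf_partial ` {1..n} :: 'k::field vfield set) = n"
proof -
  have inj: "inj_on (vf_partial :: nat \<Rightarrow> 'k vfield) A" for A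
    by (rule inj_onI) (metis lookup_vf_partial zero_neq_one)
  then show "card (vf_partial ` {1..n} :: 'k vfield set) = n" by (simp add: card_image)
  show "vf.independent (vf_partial ` {1..n} :: 'k vfield set)"
  proof (rule vf.independent_if_scalars_zero)
    fix f :: "'k vfield \<Rightarrow> 'k" and X :: "'k vfield"
    assume sum: "(\<Sum>X\<in>vf_partial ` {1..n}. vf_scale (f X) X) = 0" and X: "X \<in> vf_partial ` {1..n}"
    obtain i where i: "i \<in> {1..n}" "X = vf_partial i" using X by blast
    have "0 = lookup (lookup (\<Sum>X\<in>vf_partial ` {1..n}. vf_scale (f X) X) i) 0" using sum by simp
    also have "\<dots> = (\<Sum>X\<in>vf_partial ` {1..n}. f X * lookup (lookup X i) 0)"
      by (simp add: lookup_sum lookup_vf_scale)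
    also have "\<dots> = (\<Sum>j\<in>{1..n}. if i = j then f (vf_partial i) else 0)"
      by (rule sum.reindex_cong[OF inj refl]) (simp add: lookup_vf_partial)
    finally show "f X = 0" using i by simp
  qed simp
qed

text \<open>Depths are at least 1 and add up under brackets, so a bracket or a square lies strictly
  deeper than its factors. As the basis is listed by increasing depth, only later basis vectors
  occur in it.\<close>

lemma (in lie_superalgebra) nilpotent_frame_of_compatible_basis:
  assumes N: "negatively_graded_of_depth d N" and basis: "compatible_basis d n N e"
    and wt: "\<And>s i. i \<in> index_set n N e s \<Longrightarrow> wt i = s"
  shows "\<exists>co. nilpotent_frame scale br sq par n e (odd_indices n par e) wt co"
proof -
  let ?J = "odd_indices n par e"
  define B where "B = e ` {1..n}"
  have inj: "inj_on e {1..n}" and ind: "independent B" and spn: "span B = UNIV"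
    and hom: "i \<in> {1..n} \<Longrightarrow> e i \<in> par False \<union> par True"
    and I_un: "{1..n} = (\<Union>s\<in>{1..d}. index_set n N e s)"
    and I_span: "s \<in> {1..d} \<Longrightarrow> span (e ` index_set n N e s) = N (- int s)"
    and I_order: "\<lbrakk>s \<in> {1..d}; t \<in> {1..d}; s < t; i \<in> index_set n N e s; j \<in> index_set n N e t\<rbrakk> \<Longrightarrow> i < j"
    for i s t j
    using basis unfolding compatible_basis_def B_def by blast+
  have fin: "finite B" by (simp add: B_def)
  define co where "co = (\<lambda>x j. if j \<in> {1..n} then representation B x (e j) else 0)"
  have co_add: "co (x + y) j = co x j + co y j" for x y j
    by (simp add: co_def representation_add[OF ind] spn)
  have co_scale: "co (scale c x) j = c * co x j" for c x j
    by (simp add: co_def representation_scale[OF ind] spn)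
  have co_zero: "co 0 j = 0" for j by (simp add: co_def representation_zero)
  have co_sum: "co (sum f A) j = (\<Sum>a\<in>A. co (f a) j)" for f and A :: "nat set" and j
    by (induction A rule: infinite_finite_induct) (simp_all add: co_zero co_add)
  have co_e: "co (e i) j = (if i = j then 1 else 0)" if "i \<in> {1..n}" for i j
  proof -
    have "e i \<in> B" using that by (simp add: B_def)
    then have "co (e i) j = (if j \<in> {1..n} then if e j = e i then 1 else 0 else 0)"
      by (simp add: co_def representation_basis[OF ind])
    then show ?thesis
      using that inj_on_eq_iff[OF inj, of j i] by auto
  qed
  have co_out: "co x j = 0" if "j \<notin> {1..n}" for x j
    using that by (simp add: co_def del: atLeastAtMost_iff)
  have expand: "x = (\<Sum>j\<in>{1..n}. scale (co x j) (e j))" for x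
  proof -
    have "x = (\<Sum>b\<in>B. scale (representation B x b) b)"
      by (rule sum_representation_eq[OF ind, symmetric]) (simp_all add: spn fin)
    also have "\<dots> = (\<Sum>j\<in>{1..n}. scale (co x j) (e j))"
      unfolding B_def sum.reindex[OF inj] by (simp add: co_def B_def)
    finally show ?thesis .
  qed
  have e_par: "e j \<in> par (j \<in> ?J)" if "j \<in> {1..n}" for j
    using hom[OF that] that by (cases "e j \<in> par True") (simp_all add: odd_indices_def)
  have par_sumI: "(\<Sum>j\<in>A. scale (co x j) (e j)) \<in> par p"
    if "\<And>j. j \<in> A \<Longrightarrow> j \<in> {1..n} \<and> (j \<in> ?J) = p" for A x p
  proof (intro subspace_sum subspace_scale par_subspace)
    show "e j \<in> par p" if "j \<in> A" for j
      using \<open>\<And>j. j \<in> A \<Longrightarrow> j \<in> {1..n} \<and> (j \<in> ?J) = p\<close>[OF that] e_par[of j] by simp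
  qed
  have par_iff: "x \<in> par p \<longleftrightarrow> (\<forall>j. co x j \<noteq> 0 \<longrightarrow> (j \<in> ?J) = p)" for x p
  proof
    assume r: "\<forall>j. co x j \<noteq> 0 \<longrightarrow> (j \<in> ?J) = p"
    have "x = (\<Sum>j\<in>{1..n}. scale (co x j) (e j))" by (rule expand)
    also have "\<dots> = (\<Sum>j\<in>{j\<in>{1..n}. (j \<in> ?J) = p}. scale (co x j) (e j))"
      using r by (intro sum.mono_neutral_right) auto
    also have "\<dots> \<in> par p" by (rule par_sumI) auto
    finally show "x \<in> par p" .
  next
    assume x: "x \<in> par p"
    \<comment> \<open>The part \<open>S ?C\<close> of the wrong parity lies in both
      \<open>par p\<close> and \<open>par (\<not> p)\<close>; hence it vanishes, and its coordinates
      with it.\<close>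
    let ?A = "{j\<in>{1..n}. (j \<in> ?J) = p}" and ?C = "{j\<in>{1..n}. (j \<in> ?J) = (\<not> p)}"
    define S where "S A = (\<Sum>j\<in>A. scale (co x j) (e j))" for A
    have "x = S {1..n}" unfolding S_def by (rule expand)
    also have "{1..n} = ?A \<union> ?C" by auto
    also have "S \<dots> = S ?A + S ?C" unfolding S_def by (rule sum.union_disjoint) auto
    finally have "S ?C = x - S ?A" by simp
    moreover have "S ?A \<in> par p" unfolding S_def by (rule par_sumI) auto
    ultimately have "S ?C \<in> par p" using subspace_diff[OF par_subspace x] by simp
    moreover have "S ?C \<in> par (\<not> p)" unfolding S_def by (rule par_sumI) auto
    ultimately have "S ?C = 0" using par_disjoint by (cases p) auto
    have "co x j = 0" if j: "j \<in> ?C" for j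
    proof -
      have "co (S ?C) j = (\<Sum>l\<in>?C. if l = j then co x j else 0)"
        unfolding S_def co_sum co_scale by (rule sum.cong) (auto simp: co_e)
      also have "\<dots> = co x j" by (subst sum.delta) (use j in simp_all)
      finally show ?thesis using \<open>S ?C = 0\<close> by (simp add: co_zero)
    qed
    then show "\<forall>j. co x j \<noteq> 0 \<longrightarrow> (j \<in> ?J) = p" using co_out[of _ x] by blast
  qed
  have I: "wt j \<in> {1..d}" "j \<in> index_set n N e (wt j)" "e j \<in> N (- int (wt j))" if "j \<in> {1..n}" for j
  proof -
    from that[unfolded I_un] obtain s where s: "s \<in> {1..d}" "j \<in> index_set n N e s" by blast
    with wt[OF s(2)] show "wt j \<in> {1..d}" "j \<in> index_set n N e (wt j)" by simp_all
    then show "e j \<in> N (- int (wt j))" by (simp add: index_set_def)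
  qed
  have gr: "graded N" and deep: "k < - int d \<Longrightarrow> N k = {0}" for k
    using N unfolding negatively_graded_of_depth_def by auto
  \<comment> \<open>Up to depth \<open>d\<close> the space \<open>N (- int s)\<close> is spanned by
    the basis vectors of weight \<open>s\<close>; beyond \<open>d\<close> it is zero and has no
    nonzero coordinates.\<close>
  have wt_N: "wt l = s" if x: "x \<in> N (- int s)" and nz: "co x l \<noteq> 0" and s: "s \<ge> 1" for x l s
  proof (cases "s \<le> d")
    case True
    with s have "x \<in> span (e ` index_set n N e s)" using x I_span by auto
    then have "\<forall>l. l \<notin> index_set n N e s \<longrightarrow> co x l = 0"
    proof (induction rule: span_induct_alt)
      case base
      then show ?case by (simp add: co_zero)
    next
      case (step c y z)
      then show ?case by (auto simp: co_add co_scale co_e index_set_def split: if_splits)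
    qed
    then show ?thesis using nz wt by blast
  next
    case False
    then show ?thesis using deep[of "- int s"] x nz co_zero by auto
  qed
  have lt: "j < l" if "j \<in> {1..n}" "l \<in> {1..n}" "wt j < wt l" for j l
    using I_order I that by blast
  have br_N: "br x y \<in> N (k + l)" if "x \<in> N k" "y \<in> N l" for x y k l
    using gr that unfolding graded_def by blast
  have sq_N: "sq x \<in> N (2 * k)" if "CHAR('k) = 2" "x \<in> N k" "x \<in> par True" for x k
    using gr that unfolding graded_def by blast
  have "nilpotent_frame scale br sq par n e ?J wt co"
  proof (unfold_locales)
    show "?J \<subseteq> {1..n}" by (auto simp: odd_indices_def)
    show "j < l \<and> k < l \<and> wt l = wt j + wt k"
      if j: "j \<in> {1..n}" and k: "k \<in> {1..n}" and nz: "co (br (e j) (e k)) l \<noteq> 0" for j k l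
    proof -
      have "br (e j) (e k) \<in> N (- int (wt j + wt k))"
        using br_N[OF I(3)[OF j] I(3)[OF k]] by simp
      then have w: "wt l = wt j + wt k" using wt_N[OF _ nz] I(1)[OF j] by simp
      have "l \<in> {1..n}" using nz co_out by blast
      then show ?thesis using lt[OF j] lt[OF k] w I(1)[OF j] I(1)[OF k] by simp
    qed
    show "j < l \<and> wt l = 2 * wt j"
      if c2: "CHAR('k) = 2" and j: "j \<in> ?J" and nz: "co (sq (e j)) l \<noteq> 0" for j l
    proof -
      have j': "j \<in> {1..n}" "e j \<in> par True" using j by (auto simp: odd_indices_def)
      have "sq (e j) \<in> N (- int (2 * wt j))"
        using sq_N[OF c2 I(3)[OF j'(1)] j'(2)] by simp
      then have w: "wt l = 2 * wt j" using wt_N[OF _ nz] I(1)[OF j'(1)] by simp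
      have "l \<in> {1..n}" using nz co_out by blast
      then show ?thesis using lt[OF j'(1)] w I(1)[OF j'(1)] by simp
    qed
  qed (fact co_add co_scale co_e co_out expand par_iff)+
  then show ?thesis by blast
qed

theorem mainTheorem1:
  fixes scale :: "'k::field \<Rightarrow> 'a::ab_group_add \<Rightarrow> 'a"
    and br :: "'a \<Rightarrow> 'a \<Rightarrow> 'a"
    and sq :: "'a \<Rightarrow> 'a"
    and par :: "bool \<Rightarrow> 'a set"
    and N :: "int \<Rightarrow> 'a set"
    and e :: "nat \<Rightarrow> 'a"
    and d n :: nat
    and wt :: "nat \<Rightarrow> nat"
  assumes K: "real_complex_or_pos_char TYPE('k)"
    and L: "lie_superalgebra scale br sq par"
    and N: "lie_superalgebra.negatively_graded_of_depth scale br sq par d N"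
    and d: "d > 1"
    and gen: "lie_superalgebra.generated_by scale br sq par (N (- 1))"
    and dim: "vector_space.dim scale (UNIV :: 'a set) = n"
    and e: "lie_superalgebra.compatible_basis scale par d n N e"
    and wt: "\<And>s i. i \<in> index_set n N e s \<Longrightarrow> wt i = s"
  defines "I \<equiv> index_set n N e"
    and "J \<equiv> odd_indices n par e"
  shows "\<exists>f. lie_superalgebra.embedding_into_vect scale br sq par n J f \<and>
           (\<forall>s. \<forall>i\<in>I s. f (e i) \<in> vect_deg n J wt (- int s)) \<and>
           (\<forall>i\<in>{1..n}. value_at_0 (f (e i)) = vf_partial i) \<and>
           vector_space.dim vf_scale (module.span vf_scale (value_at_0 ` range f)) = n"
proof -
  interpret lie_superalgebra scale br sq par by (rule L)
  obtain co where "nilpotent_frame scale br sq par n e J wt co"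
    using nilpotent_frame_of_compatible_basis[OF N e, of wt] wt unfolding J_def by blast
  then interpret F: nilpotent_frame scale br sq par n e J wt co .
  obtain f where f: "F.realizes 1 f" using F.exists_realization by blast
  note emb = F.realizes_embedding[OF f]
  \<comment> \<open>The values at 0 are combinations of the \<open>\<partial>\<^sub>i\<close> and
    include each of them, so their span has dimension \<open>n\<close>.\<close>
  have value_f: "value_at_0 (f x) = (\<Sum>j\<in>{1..n}. vf_scale (co x j) (vf_partial j))" for x
    by (rule vfield_eqI) (auto simp: lookup_value_at_0 emb(3) lookup_sum lookup_vf_scale
        lookup_vf_partial F.co_out if_distrib cong: if_cong)
  have value_e: "value_at_0 (f (e i)) = vf_partial i" if "i \<in> {1..n}" for i
    by (rule vfield_eqI) (simp add: lookup_value_at_0 emb(3) lookup_vf_partial F.co_e[OF that])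
  have "vf.span (value_at_0 ` range f) = vf.span (vf_partial ` {1..n})"
  proof (rule vf.span_eq[THEN iffD2], intro conjI subsetI)
    fix X assume "X \<in> value_at_0 ` range f"
    then obtain x where "X = value_at_0 (f x)" by blast
    then show "X \<in> vf.span (vf_partial ` {1..n})"
      unfolding value_f by (auto intro!: vf.span_sum vf.span_scale intro: vf.span_base)
  next
    fix X :: "'k vfield" assume "X \<in> vf_partial ` {1..n}"
    then show "X \<in> vf.span (value_at_0 ` range f)"
      using value_e by (metis imageE rangeI imageI vf.span_base)
  qed
  then have "vf.dim (vf.span (value_at_0 ` range f)) = n"
    using vf.dim_span_eq_card_independent[OF independent_vf_partial] card_vf_partial by metis
  moreover have "f (e i) \<in> vect_deg n J wt (- int s)" if "i \<in> I s" for i s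
  proof -
    have "i \<in> {1..n}" "wt i = s" using that wt by (auto simp: I_def index_set_def)
    then show ?thesis using emb(2)[of i] by simp
  qed
  ultimately show ?thesis using emb(1) value_e by blast
qed

end
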